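(* Let $N>1$, $1<p<\infty$, let $B_\rho\subset\mathbb{R}^N$ be the ball of radius $\rho>0$ centered at $x_0$, let $\omega_\rho\colon[0,\rho]\to[0,\infty)$ be continuous with isolated zeros, and let $f\colon[0,\infty)\times[0,\infty)\to[0,\infty)$ be continuous. Let $k_1(B_\rho)$, $k_2(B_\rho)$, $\gamma_\rho$, $\Psi_\delta$, $\Phi_M$, $\Gamma_M$ be as defined in the context. Suppose that there are $\delta,M$ with $0<\delta<M$ such that (1) $0\le f(u,|v|)\le k_1(B_\rho)M^{p-1}$ whenever $0\le u\le M$ and $|v|\le\gamma_\rho M$; (2) $f(u,|v|)\ge k_2(B_\rho)\delta^{p-1}$ whenever $\delta\le u\le M$ and $|v|\le\gamma_\rho M$. Then the problem $$-\Delta_pu=\omega_\rho(|x-x_0|)f(u,|\nabla u|)\ \text{ in }B_\rho,\qquad u=0\ \text{ on }\partial B_\rho,$$ has at least one positive (radial) solution $u_\rho(|x-x_0|)$ satisfying $$\Psi_\delta\le u_\rho\le\Phi_M\quad\text{and}\quad|\nabla u_\rho|\le\Gamma_M$$ (as functions of $r=|x-x_0|$), and so $\delta\le\|u_\rho\|_\infty\le M$ and $\|\nabla u_\rho\|_\infty\le\gamma_\rho M$.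
   Context: $\Delta_pu=\operatorname{div}(|\nabla u|^{p-2}\nabla u)$ is the $p$-Laplacian; solutions are understood in the weak sense: $u\in W^{1,p}(B_\rho)\cap L^\infty(B_\rho)$, $u=0$ on $\partial B_\rho$, and $\int|\nabla u|^{p-2}\nabla u\cdot\nabla\phi\,dx=\int\omega_\rho f(u,|\nabla u|)\phi\,dx$ for all $\phi\in C_0^\infty(B_\rho)$. Put $\varphi_q(\xi)=\xi^{1/(p-1)}$ for $\xi\ge0$ and $K(s,\theta)=\left(\frac{s}{\theta}\right)^{N-1}\omega_\rho(s)$. Let $$\phi_\rho(r)=\int_r^\rho\varphi_q\left(\int_0^\theta K(s,\theta)\,ds\right)d\theta ,$$ so that $\phi_\rho(|x-x_0|)$ is the solution of $-\Delta_p\phi_\rho=\omega_\rho(|x-x_0|)$ in $B_\rho$, $\phi_\rho=0$ on $\partial B_\rho$. Define $$k_1(B_\rho)=\|\phi_\rho\|_\infty^{-(p-1)},\qquad \gamma_\rho=\max_{0\le r\le\rho}\varphi_q\left(k_1(B_\rho)\int_0^rK(s,r)\,ds\right)=\frac{\|\nabla\phi_\rho\|_\infty}{\|\phi_\rho\|_\infty},$$ $$k_2(B_\rho)=\left[\max_{0\le r\le\rho}\int_r^\rho\varphi_q\left(\int_0^rK(s,\theta)\,ds\right)d\theta\right]^{1-p}=\left[\int_t^\rho\varphi_q\left(\int_0^tK(s,\theta)\,ds\right)d\theta\right]^{1-p},$$ where $t\in(0,\rho)$ is a point at which this maximum is attained. Finally, $$\Psi_\delta(r)=\begin{cases}\delta,&0\le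 r\le t,\\ \delta\int_r^\rho\varphi_q\left(k_2(B_\rho)\int_0^tK(s,\theta)\,ds\right)d\theta,&t<r\le\rho,\end{cases}$$ $$\Phi_M(r)=M\int_r^\rho\varphi_q\left(k_1(B_\rho)\int_0^\theta K(s,\theta)\,ds\right)d\theta=M\frac{\phi_\rho(r)}{\|\phi_\rho\|_\infty},$$ $$\Gamma_M(r)=M\varphi_q\left(k_1(B_\rho)\int_0^rK(s,r)\,ds\right)=M\frac{|\phi_\rho'(r)|}{\|\phi_\rho\|_\infty}$$ (extended continuously to $r=0$). *)

theory Defs
  imports "HOL-Analysis.Analysis" "HOL-Probability.Essential_Supremum"
begin

section \<open>Test functions and Sobolev functions\<close>

definition partial_deriv :: "'a::euclidean_space \<Rightarrow> ('a \<Rightarrow> real) \<Rightarrow> 'a \<Rightarrow> real" where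
  "partial_deriv i \<phi> x = frechet_derivative \<phi> (at x) i"

definition grad :: "('a::euclidean_space \<Rightarrow> real) \<Rightarrow> 'a \<Rightarrow> 'a" where
  "grad \<phi> x = (\<Sum>i\<in>Basis. partial_deriv i \<phi> x *\<^sub>R i)"

fun C_k :: "nat \<Rightarrow> ('a::euclidean_space \<Rightarrow> real) \<Rightarrow> bool" where
  "C_k 0 \<phi> \<longleftrightarrow> continuous_on UNIV \<phi>"
| "C_k (Suc k) \<phi> \<longleftrightarrow> \<phi> differentiable_on UNIV \<and> (\<forall>i\<in>Basis. C_k k (partial_deriv i \<phi>))"

text \<open>The space \<open>C\<^sub>0\<^sup>\<infinity>(\<Omega>)\<close>; its elements are extended by zero outside \<open>\<Omega>\<close>.\<close>

definition test_functions :: "'a::euclidean_space set \<Rightarrow> ('a \<Rightarrow> real) set" where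
  "test_functions \<Omega> =
     {\<phi>. (\<forall>k. C_k k \<phi>) \<and> compact (closure {x. \<phi> x \<noteq> 0}) \<and> closure {x. \<phi> x \<noteq> 0} \<subseteq> \<Omega>}"

definition in_Lp :: "real \<Rightarrow> 'a::euclidean_space set \<Rightarrow> ('a \<Rightarrow> 'b::euclidean_space) \<Rightarrow> bool" where
  "in_Lp p \<Omega> g \<longleftrightarrow> g \<in> borel_measurable (lebesgue_on \<Omega>) \<and>
     integrable (lebesgue_on \<Omega>) (\<lambda>x. norm (g x) powr p)"

definition Linf_norm :: "'a::euclidean_space set \<Rightarrow> ('a \<Rightarrow> 'b::euclidean_space) \<Rightarrow> ereal" where
  "Linf_norm \<Omega> g = esssup (lebesgue_on \<Omega>) (\<lambda>x. ereal (norm (g x)))"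

definition in_Linf :: "'a::euclidean_space set \<Rightarrow> ('a \<Rightarrow> 'b::euclidean_space) \<Rightarrow> bool" where
  "in_Linf \<Omega> g \<longleftrightarrow> g \<in> borel_measurable (lebesgue_on \<Omega>) \<and> Linf_norm \<Omega> g < \<infinity>"

definition has_weak_gradient ::
  "'a::euclidean_space set \<Rightarrow> ('a \<Rightarrow> real) \<Rightarrow> ('a \<Rightarrow> 'a) \<Rightarrow> bool" where
  "has_weak_gradient \<Omega> u Du \<longleftrightarrow>
     (\<forall>C. compact C \<and> C \<subseteq> \<Omega> \<longrightarrow> u absolutely_integrable_on C \<and> Du absolutely_integrable_on C) \<and>
     (\<forall>\<phi>\<in>test_functions \<Omega>. \<forall>i\<in>Basis.
        (\<integral>x. u x * partial_deriv i \<phi> x \<partial>lebesgue_on \<Omega>) = - (\<integral>x. (Du x \<bullet> i) * \<phi> x \<partial>lebesgue_on \<Omega>))"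

text \<open>\<open>u \<in> W\<^sup>1\<^sup>,\<^sup>p(\<Omega>)\<close> with weak gradient (represented by) \<open>Du\<close>.\<close>

definition in_W1p :: "real \<Rightarrow> 'a::euclidean_space set \<Rightarrow> ('a \<Rightarrow> real) \<Rightarrow> ('a \<Rightarrow> 'a) \<Rightarrow> bool" where
  "in_W1p p \<Omega> u Du \<longleftrightarrow> has_weak_gradient \<Omega> u Du \<and> in_Lp p \<Omega> u \<and> in_Lp p \<Omega> Du"

text \<open>
  Weak solutions \<open>u\<close>, with weak gradient \<open>Du\<close>, of the Dirichlet problem
  \<open>- \<Delta>\<^sub>p u = F(x, u, |\<nabla>u|)\<close> in \<open>\<Omega>\<close>, \<open>u = 0\<close> on the boundary. The boundary values are those of
  a representative that is continuous up to the boundary, for which they coincide with the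
  Sobolev trace. The convention \<open>0 powr a = 0\<close> gives the vector field \<open>|Du|\<^sup>p\<^sup>-\<^sup>2 Du\<close> its usual
  value \<open>0\<close> where \<open>Du\<close> vanishes, also for \<open>p < 2\<close>.
\<close>

definition p_Laplace_weak_solution ::
  "real \<Rightarrow> 'a::euclidean_space set \<Rightarrow> ('a \<Rightarrow> real \<Rightarrow> real \<Rightarrow> real) \<Rightarrow> ('a \<Rightarrow> real) \<Rightarrow> ('a \<Rightarrow> 'a) \<Rightarrow> bool"
where
  "p_Laplace_weak_solution p \<Omega> F u Du \<longleftrightarrow>
     in_W1p p \<Omega> u Du \<and> in_Linf \<Omega> u \<and>
     continuous_on (closure \<Omega>) u \<and> (\<forall>x\<in>frontier \<Omega>. u x = 0) \<and>
     (\<forall>\<phi>\<in>test_functions \<Omega>.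
        integrable (lebesgue_on \<Omega>) (\<lambda>x. (norm (Du x) powr (p - 2) *\<^sub>R Du x) \<bullet> grad \<phi> x) \<and>
        integrable (lebesgue_on \<Omega>) (\<lambda>x. F x (u x) (norm (Du x)) * \<phi> x) \<and>
        (\<integral>x. (norm (Du x) powr (p - 2) *\<^sub>R Du x) \<bullet> grad \<phi> x \<partial>lebesgue_on \<Omega>) =
        (\<integral>x. F x (u x) (norm (Du x)) * \<phi> x \<partial>lebesgue_on \<Omega>))"

section \<open>The radial quantities\<close>

text \<open>
  Parameters: \<open>N\<close> is the space dimension, \<open>\<omega>\<close> the radial weight on \<open>[0, \<rho>]\<close>. With \<open>x / 0 = 0\<close> and
  integrals over \<open>{0..0}\<close> being \<open>0\<close>, the expression \<open>\<integral>\<^sub>0\<^sup>r K(s, r) ds\<close> is \<open>0\<close> at \<open>r = 0\<close>, which is its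
  continuous extension. The functions whose supremum is taken below are continuous on \<open>[0, \<rho>]\<close>,
  so that each supremum is a maximum.
\<close>

definition phi_q :: "real \<Rightarrow> real \<Rightarrow> real" where
  "phi_q p \<xi> = \<xi> powr (1 / (p - 1))"

definition K :: "nat \<Rightarrow> (real \<Rightarrow> real) \<Rightarrow> real \<Rightarrow> real \<Rightarrow> real" where
  "K N \<omega> s \<theta> = (s / \<theta>) ^ (N - 1) * \<omega> s"

definition phi_rho :: "nat \<Rightarrow> real \<Rightarrow> (real \<Rightarrow> real) \<Rightarrow> real \<Rightarrow> real \<Rightarrow> real" where
  "phi_rho N p \<omega> \<rho> r = integral {r..\<rho>} (\<lambda>\<theta>. phi_q p (integral {0..\<theta>} (\<lambda>s. K N \<omega> s \<theta>)))"

definition k1 :: "nat \<Rightarrow> real \<Rightarrow> (real \<Rightarrow> real) \<Rightarrow> real \<Rightarrow> real" where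
  "k1 N p \<omega> \<rho> = (SUP r\<in>{0..\<rho>}. \<bar>phi_rho N p \<omega> \<rho> r\<bar>) powr (- (p - 1))"

definition gamma_rho :: "nat \<Rightarrow> real \<Rightarrow> (real \<Rightarrow> real) \<Rightarrow> real \<Rightarrow> real" where
  "gamma_rho N p \<omega> \<rho> =
     (SUP r\<in>{0..\<rho>}. phi_q p (k1 N p \<omega> \<rho> * integral {0..r} (\<lambda>s. K N \<omega> s r)))"

definition k2_integral :: "nat \<Rightarrow> real \<Rightarrow> (real \<Rightarrow> real) \<Rightarrow> real \<Rightarrow> real \<Rightarrow> real" where
  "k2_integral N p \<omega> \<rho> r =
     integral {r..\<rho>} (\<lambda>\<theta>. phi_q p (integral {0..r} (\<lambda>s. K N \<omega> s \<theta>)))"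

definition k2 :: "nat \<Rightarrow> real \<Rightarrow> (real \<Rightarrow> real) \<Rightarrow> real \<Rightarrow> real" where
  "k2 N p \<omega> \<rho> = (SUP r\<in>{0..\<rho>}. k2_integral N p \<omega> \<rho> r) powr (1 - p)"

definition Psi :: "nat \<Rightarrow> real \<Rightarrow> (real \<Rightarrow> real) \<Rightarrow> real \<Rightarrow> real \<Rightarrow> real \<Rightarrow> real \<Rightarrow> real" where
  "Psi N p \<omega> \<rho> t \<delta> r =
     (if r \<le> t then \<delta>
      else \<delta> * integral {r..\<rho>} (\<lambda>\<theta>. phi_q p (k2 N p \<omega> \<rho> * integral {0..t} (\<lambda>s. K N \<omega> s \<theta>))))"

definition Phi :: "nat \<Rightarrow> real \<Rightarrow> (real \<Rightarrow> real) \<Rightarrow> real \<Rightarrow> real \<Rightarrow> real \<Rightarrow> real" where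
  "Phi N p \<omega> \<rho> M r =
     M * integral {r..\<rho>} (\<lambda>\<theta>. phi_q p (k1 N p \<omega> \<rho> * integral {0..\<theta>} (\<lambda>s. K N \<omega> s \<theta>)))"

definition Gamma_bound :: "nat \<Rightarrow> real \<Rightarrow> (real \<Rightarrow> real) \<Rightarrow> real \<Rightarrow> real \<Rightarrow> real \<Rightarrow> real" where
  "Gamma_bound N p \<omega> \<rho> M r =
     M * phi_q p (k1 N p \<omega> \<rho> * integral {0..r} (\<lambda>s. K N \<omega> s r))"

end

theory Submission
  imports Defs "HOL-Complex_Analysis.Great_Picard"
begin

text \<open>
  Truncate \<open>f\<close> so that its first argument is clamped to \<open>[\<Psi>\<^sub>\<delta>(r), M]\<close> and its second one to
  \<open>[0, \<gamma>\<^sub>\<rho> M]\<close>. The hypotheses on \<open>f\<close> then hold for all arguments, and integrating the radial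
  equation twice shows that every radial solution of the truncated problem satisfies
  \<open>\<Psi>\<^sub>\<delta> \<le> u \<le> \<Phi>\<^sub>M\<close> and \<open>|u'| \<le> \<Gamma>\<^sub>M\<close>, hence solves the original problem.

  The truncated radial problem is a planar first-order system with bounded continuous right-hand
  side for \<open>u\<close> and its flux, with one condition at each endpoint. Schauder's fixed point theorem
  is avoided: the system with a small delay is solved step by step and depends continuously on
  \<open>u(0)\<close>, so the intermediate value theorem meets the condition at \<open>\<rho>\<close>, and the delay is removed
  with the Arzela-Ascoli theorem.

  Integration by parts over the ball uses neither Fubini's theorem nor the divergence theorem:
  Lebesgue measure is invariant under translations and scales under dilations about the centre,
  and differentiating under the integral sign gives the weak gradient and the weak equation.
\<close>

section \<open>A planar boundary value problem\<close>

text \<open>The lower clamp excludes the zero solution: f may vanish at 0, but a first argument kept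
  at or above \<Psi>_\<delta> is at least \<delta> on [0,t], so hypothesis (2) applies there before
  anything is known about u. Beyond t only f >= 0 is used, because the mass collected in [0,t]
  already produces the slope of \<Psi>_\<delta>. This is why \<open>k2\<close> comes from a kernel
  integral frozen at t, and the maximising t makes the required constant as small as possible. The
  delay is there because neither f nor \<open>phi_q\<close> need be Lipschitz: an initial value
  problem may have several solutions, so u(0) need not determine u(\<rho>), let alone continuously.
  The other obstacle is the centre, where the flux is divided by r^(N-1). It dictates the clamp of
  that quotient, the one-sided derivatives at 0 and the exceptional point in the dilation
  argument.\<close>

lemma continuous_on_delayed_field:
  fixes G :: "real \<Rightarrow> 'b::euclidean_space \<Rightarrow> 'b"
  assumes G: "continuous_on ({0..T} \<times> UNIV) (\<lambda>(s, z). G s z)"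
    and h: "0 \<le> h" and z: "continuous_on {0..T} z"
  shows "continuous_on {0..T} (\<lambda>s. G s (z (max 0 (s - h))))"
proof -
  have "continuous_on {0..T} (\<lambda>s. z (max 0 (s - h)))"
    by (rule continuous_on_compose2[OF z]) (use h in \<open>auto intro!: continuous_intros\<close>)
  then have "continuous_on {0..T} (\<lambda>s. (s, z (max 0 (s - h))))"
    by (intro continuous_intros)
  from continuous_on_compose2[OF G this] show ?thesis
    by auto
qed

lemma continuous_on_field_snd:
  assumes G: "continuous_on ({0..T} \<times> UNIV) (\<lambda>(s, z). G s z)" and s: "s \<in> {0..T}"
  shows "continuous_on UNIV (G s)"
proof -
  have "continuous_on UNIV (\<lambda>z. (s, z))"
    by (intro continuous_intros)
  from continuous_on_compose2[OF G this] s have "continuous_on UNIV (\<lambda>z. (\<lambda>(s, z). G s z) (s, z))"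
    by blast
  then show ?thesis
    by simp
qed

text \<open>Method of steps: the delayed argument sees only values fixed one step earlier, so each
  step is a single integration and no fixed point is involved. \<open>max 0 (s - h)\<close> prolongs
  the history before time 0 by the initial value \<open>a\<close>. Continuity in \<open>a\<close> is
  tracked pointwise in \<open>r\<close>, which dominated convergence preserves and the intermediate
  value theorem can use.\<close>

lemma delayed_ode_flow_exists:
  fixes G :: "real \<Rightarrow> 'b::euclidean_space \<Rightarrow> 'b"
  assumes G: "continuous_on ({0..T} \<times> UNIV) (\<lambda>(s, z). G s z)"
    and bnd: "\<And>s z. s \<in> {0..T} \<Longrightarrow> norm (G s z) \<le> C"
    and h: "0 < h"
  shows "\<exists>W :: 'b \<Rightarrow> real \<Rightarrow> 'b. \<forall>a. continuous_on {0..T} (W a) \<and>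
    (\<forall>r\<in>{0..T}. W a r = a + integral {0..r} (\<lambda>s. G s (W a (max 0 (s - h))))) \<and>
    (\<forall>r\<in>{0..T}. continuous_on UNIV (\<lambda>a. W a r))"
proof -
  have step: "\<exists>W :: 'b \<Rightarrow> real \<Rightarrow> 'b. \<forall>a. continuous_on {0..T} (W a) \<and>
    (\<forall>r\<in>{0..T}. r \<le> real k * h \<longrightarrow> W a r = a + integral {0..r} (\<lambda>s. G s (W a (max 0 (s - h))))) \<and>
    (\<forall>r\<in>{0..T}. continuous_on UNIV (\<lambda>a. W a r))" for k
  proof (induction k)
    case 0
    show ?case
      \<comment> \<open>For k = 0 the equation is demanded only at r = 0, so the constant flow
        serves.\<close>
      by (rule exI[of _ "\<lambda>a r. a"]) (auto intro!: continuous_intros)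
  next
    case (Suc k)
    then obtain W :: "'b \<Rightarrow> real \<Rightarrow> 'b" where
      Wc: "\<And>a. continuous_on {0..T} (W a)" and
      We: "\<And>a r. r \<in> {0..T} \<Longrightarrow> r \<le> real k * h \<Longrightarrow>
             W a r = a + integral {0..r} (\<lambda>s. G s (W a (max 0 (s - h))))" and
      Wa: "\<And>r. r \<in> {0..T} \<Longrightarrow> continuous_on UNIV (\<lambda>a. W a r)"
      by blast
    define V where "V = (\<lambda>a r. a + integral {0..r} (\<lambda>s. G s (W a (max 0 (s - h)))))"
    have dc: "continuous_on {0..T} (\<lambda>s. G s (W a (max 0 (s - h))))" for a
      using continuous_on_delayed_field[OF G _ Wc] h by simp
    have int: "(\<lambda>s. G s (W a (max 0 (s - h)))) integrable_on {0..r}" if "r \<in> {0..T}" for a r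
      by (rule integrable_continuous_real, rule continuous_on_subset[OF dc]) (use that in auto)
    have 1: "continuous_on {0..T} (V a)" for a
      unfolding V_def
      by (intro continuous_intros indefinite_integral_continuous_1 integrable_continuous_real dc)
    have 2: "V a r = a + integral {0..r} (\<lambda>s. G s (V a (max 0 (s - h))))"
      if r: "r \<in> {0..T}" "r \<le> real (Suc k) * h" for a r
    proof -
      \<comment> \<open>For s up to (k+1) h the delayed time is at most k h, where \<open>W\<close>
        already solves the equation and therefore coincides with \<open>V\<close>.\<close>
      have "W a (max 0 (s - h)) = V a (max 0 (s - h))" if "s \<in> {0..r}" for s
        using We[of "max 0 (s - h)" a] that r h unfolding V_def by (auto simp: algebra_simps)
      then have "integral {0..r} (\<lambda>s. G s (W a (max 0 (s - h)))) =
          integral {0..r} (\<lambda>s. G s (V a (max 0 (s - h))))"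
        by (intro integral_cong) simp
      moreover have "V a r = a + integral {0..r} (\<lambda>s. G s (W a (max 0 (s - h))))"
        by (simp add: V_def)
      ultimately show ?thesis
        by simp
    qed
    have 3: "continuous_on UNIV (\<lambda>a. V a r)" if r: "r \<in> {0..T}" for r
    proof (rule continuous_on_sequentiallyI)
      fix A :: "nat \<Rightarrow> 'b" and a assume A: "A \<longlonglongrightarrow> a"
      have "(\<lambda>n. integral {0..r} (\<lambda>s. G s (W (A n) (max 0 (s - h)))))
              \<longlonglongrightarrow> integral {0..r} (\<lambda>s. G s (W a (max 0 (s - h))))"
      proof (rule dominated_convergence(2)[where h = "\<lambda>_. C"])
        show "(\<lambda>s. G s (W (A n) (max 0 (s - h)))) integrable_on {0..r}" for n
          using int r by blast
        show "(\<lambda>_. C) integrable_on {0..r}"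
          by (simp add: integrable_const_ivl)
        show "norm (G x (W (A n) (max 0 (x - h)))) \<le> C" if "x \<in> {0..r}" for n x
          using bnd that r by auto
        show "(\<lambda>n. G x (W (A n) (max 0 (x - h)))) \<longlonglongrightarrow> G x (W a (max 0 (x - h)))" if "x \<in> {0..r}" for x
        proof -
          have x: "x \<in> {0..T}" "max 0 (x - h) \<in> {0..T}" using that r h by auto
          have "isCont (G x) (W a (max 0 (x - h)))" "isCont (\<lambda>a. W a (max 0 (x - h))) a"
            using continuous_on_field_snd[OF G x(1)] Wa[OF x(2)] by (auto simp: continuous_on_eq_continuous_at)
          then show ?thesis
            by (rule isCont_tendsto_compose[OF _ isCont_tendsto_compose[OF _ A]])
        qed
      qed
      then show "(\<lambda>n. V (A n) r) \<longlonglongrightarrow> V a r"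
        unfolding V_def by (intro tendsto_add A)
    qed
    show ?case
      by (rule exI[of _ V]) (intro allI conjI ballI impI 1 2 3)
  qed
  obtain k :: nat where k: "T / h < real k"
    using reals_Archimedean2 by blast
  have rk: "r \<le> real k * h" if "r \<in> {0..T}" for r
    using that k h by (auto simp: field_simps)
  from step[of k] obtain W :: "'b \<Rightarrow> real \<Rightarrow> 'b" where
    "\<And>a. continuous_on {0..T} (W a)"
    "\<And>a r. r \<in> {0..T} \<Longrightarrow> r \<le> real k * h \<Longrightarrow>
      W a r = a + integral {0..r} (\<lambda>s. G s (W a (max 0 (s - h))))"
    "\<And>r. r \<in> {0..T} \<Longrightarrow> continuous_on UNIV (\<lambda>a. W a r)"
    by blast
  note W = this
  show ?thesis
    by (intro exI[of _ W] allI conjI ballI W rk)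
qed

text \<open>The components stand for u and its flux: u vanishes on the sphere and the flux at the
  centre. Since the second initial value is prescribed, a single real parameter is left to shoot
  with.\<close>

theorem bounded_planar_ode_bvp_exists:
  fixes G :: "real \<Rightarrow> real \<times> real \<Rightarrow> real \<times> real"
  assumes T: "0 \<le> T"
    and G: "continuous_on ({0..T} \<times> UNIV) (\<lambda>(s, z). G s z)"
    and bnd: "\<And>s z. s \<in> {0..T} \<Longrightarrow> norm (G s z) \<le> C"
  obtains z where "continuous_on {0..T} z" "fst (z T) = 0" "snd (z 0) = 0"
    "\<And>r. r \<in> {0..T} \<Longrightarrow> z r = z 0 + integral {0..r} (\<lambda>s. G s (z s))"
proof -
  have C: "0 \<le> C"
    using bnd[of 0 0] T by (smt (verit) atLeastAtMost_iff norm_ge_zero)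
  have "\<exists>z. continuous_on {0..T} z \<and> fst (z T) = 0 \<and> snd (z 0) = 0 \<and>
      (\<forall>r\<in>{0..T}. z r = z 0 + integral {0..r} (\<lambda>s. G s (z (max 0 (s - h)))))" if h: "0 < h" for h
  proof -
    from delayed_ode_flow_exists[OF G bnd h] obtain W :: "real \<times> real \<Rightarrow> real \<Rightarrow> real \<times> real" where
      Wc: "\<And>a. continuous_on {0..T} (W a)" and
      We: "\<And>a r. r \<in> {0..T} \<Longrightarrow> W a r = a + integral {0..r} (\<lambda>s. G s (W a (max 0 (s - h))))" and
      Wa: "\<And>r. r \<in> {0..T} \<Longrightarrow> continuous_on UNIV (\<lambda>a. W a r)"
      by metis
    have *: "norm (integral {0..T} (\<lambda>s. G s (W a (max 0 (s - h))))) \<le> C * T" for a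
    proof -
      have "continuous_on {0..T} (\<lambda>s. G s (W a (max 0 (s - h))))"
        using continuous_on_delayed_field[OF G _ Wc] h by simp
      from integral_bound[OF T this, of C] bnd show ?thesis by auto
    qed
    have **: "\<bar>fst (W (\<alpha>, 0) T) - \<alpha>\<bar> \<le> C * T" for \<alpha>
      using We[of T "(\<alpha>, 0)"] T *[of "(\<alpha>, 0)"]
        norm_fst_le[of "fst (integral {0..T} (\<lambda>s. G s (W (\<alpha>, 0) (max 0 (s - h)))))"
           "snd (integral {0..T} (\<lambda>s. G s (W (\<alpha>, 0) (max 0 (s - h)))))"]
      by simp
    have cont: "continuous_on UNIV (\<lambda>\<alpha>. fst (W (\<alpha>, 0) T))"
      by (intro continuous_on_fst continuous_on_compose2[OF Wa[of T]] continuous_intros) (use T in auto)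
    \<comment> \<open>The first component drifts by at most C T, so its final value is nonpositive
      for the start -C T and nonnegative for the start C T.\<close>
    have "\<exists>\<alpha>\<ge>- (C * T). \<alpha> \<le> C * T \<and> fst (W (\<alpha>, 0) T) = 0"
      by (rule IVT') (use **[of "C * T"] **[of "- (C * T)"] C T in \<open>auto intro: continuous_on_subset[OF cont]\<close>)
    then obtain \<alpha> where "fst (W (\<alpha>, 0) T) = 0" by blast
    then show ?thesis
      by (intro exI[of _ "W (\<alpha>, 0)"]) (use Wc[of "(\<alpha>, 0)"] We[of _ "(\<alpha>, 0)"] T in auto)
  qed
  then have "\<forall>n::nat. \<exists>z. continuous_on {0..T} z \<and> fst (z T) = 0 \<and> snd (z 0) = 0 \<and>
      (\<forall>r\<in>{0..T}. z r = z 0 + integral {0..r} (\<lambda>s. G s (z (max 0 (s - 1 / real (Suc n))))))"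
    by simp
  from choice[OF this] obtain Z :: "nat \<Rightarrow> real \<Rightarrow> real \<times> real" where
    Zc: "\<And>n. continuous_on {0..T} (Z n)" and ZT: "\<And>n. fst (Z n T) = 0" and Z0: "\<And>n. snd (Z n 0) = 0" and
    Ze: "\<And>n r. r \<in> {0..T} \<Longrightarrow>
          Z n r = Z n 0 + integral {0..r} (\<lambda>s. G s (Z n (max 0 (s - 1 / real (Suc n)))))"
    by blast
  define D where "D = (\<lambda>n s. G s (Z n (max 0 (s - 1 / real (Suc n)))))"
  have ZD: "Z n r = Z n 0 + integral {0..r} (D n)" if "r \<in> {0..T}" for n r
    using Ze[OF that] unfolding D_def .
  have Dc: "continuous_on {0..T} (D n)" for n
    unfolding D_def using continuous_on_delayed_field[OF G _ Zc[of n], of "1 / real (Suc n)"] by simp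
  have Db: "norm (D n s) \<le> C" if "s \<in> {0..T}" for n s
    unfolding D_def using bnd that by auto
  have Di: "D n integrable_on {a..b}" if "0 \<le> a" "b \<le> T" for n a b
    by (rule integrable_continuous_real, rule continuous_on_subset[OF Dc]) (use that in auto)
  \<comment> \<open>The Lipschitz constant is independent of the delay. It gives equicontinuity, and
    later shows that evaluating at a delayed time changes nothing in the limit.\<close>
  have lip: "norm (Z n r - Z n s) \<le> C * \<bar>r - s\<bar>" if "r \<in> {0..T}" "s \<in> {0..T}" for n r s
    using that
  proof (induction r s rule: linorder_wlog)
    case (le r s)
    have "integral {0..r} (D n) + integral {r..s} (D n) = integral {0..s} (D n)"
      by (rule Henstock_Kurzweil_Integration.integral_combine) (use le Di[of 0 s n] in auto)
    then have "Z n r - Z n s = - integral {r..s} (D n)"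
      using ZD[of r n] ZD[of s n] le by (simp add: algebra_simps)
    moreover have "norm (integral {r..s} (D n)) \<le> C * (s - r)"
      by (rule integral_bound) (use le Db in \<open>auto intro: continuous_on_subset[OF Dc]\<close>)
    ultimately show ?case using le by simp
  next
    case (sym r s)
    then show ?case by (simp add: norm_minus_commute abs_minus_commute)
  qed
  \<comment> \<open>The boundary conditions pin the family: one component vanishes at T and the
    other at 0, so the initial value has norm at most C T. Moving to r costs another C T; the factor
    3 leaves slack.\<close>
  have Zb: "norm (Z n r) \<le> 3 * (C * T)" if r: "r \<in> {0..T}" for n r
  proof -
    have CT: "C * \<bar>x - y\<bar> \<le> C * T" if "x \<in> {0..T}" "y \<in> {0..T}" for x y
      using that C by (intro mult_left_mono) auto
    have "\<bar>fst (Z n 0) - fst (Z n T)\<bar> \<le> norm (Z n 0 - Z n T)"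
      by (metis fst_diff norm_fst_le prod.collapse real_norm_def)
    also have "\<dots> \<le> C * T"
      using lip[of 0 T n] CT[of 0 T] T by auto
    finally have "norm (Z n 0) \<le> C * T"
      using ZT[of n] Z0[of n] by (simp add: norm_prod_def)
    moreover have "norm (Z n r - Z n 0) \<le> C * T"
      using lip[of r 0 n] CT[of r 0] r T by fastforce
    moreover have "norm (Z n r) \<le> norm (Z n r - Z n 0) + norm (Z n 0)"
      by (metis diff_add_cancel norm_triangle_ineq)
    ultimately show ?thesis using C T by (smt (verit) mult_nonneg_nonneg)
  qed
  have equi: "\<exists>d. 0 < d \<and> (\<forall>n y. y \<in> {0..T} \<and> norm (x - y) < d \<longrightarrow> norm (Z n x - Z n y) < e)"
    if "x \<in> {0..T}" "0 < e" for x e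
  proof (intro exI conjI allI impI)
    \<comment> \<open>C may be 0, hence the denominator C + 1.\<close>
    show "0 < e / (C + 1)" using that C by simp
    fix n y assume y: "y \<in> {0..T} \<and> norm (x - y) < e / (C + 1)"
    have "norm (Z n x - Z n y) \<le> C * \<bar>x - y\<bar>" using lip that y by blast
    also have "\<dots> \<le> (C + 1) * \<bar>x - y\<bar>" by (intro mult_right_mono) auto
    also have "\<dots> < e" using y C by (simp add: field_simps)
    finally show "norm (Z n x - Z n y) < e" .
  qed
  obtain z k where z: "continuous_on {0..T} z" and k: "strict_mono (k :: nat \<Rightarrow> nat)" and
    lim: "\<And>e. 0 < e \<Longrightarrow> \<exists>N. \<forall>n x. n \<ge> N \<and> x \<in> {0..T} \<longrightarrow> norm (Z (k n) x - z x) < e"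
    using Arzela_Ascoli[OF compact_Icc Zb equi] by blast
  have ptw: "(\<lambda>n. Z (k n) x) \<longlonglongrightarrow> z x" if "x \<in> {0..T}" for x
    unfolding LIMSEQ_iff using lim that by blast
  have k0: "(\<lambda>n. 1 / real (Suc (k n))) \<longlonglongrightarrow> 0"
    using LIMSEQ_subseq_LIMSEQ[OF lim_inverse_n'[THEN LIMSEQ_Suc] k] by (simp add: o_def)
  have del: "(\<lambda>n. Z (k n) (max 0 (s - 1 / real (Suc (k n))))) \<longlonglongrightarrow> z s" if s: "s \<in> {0..T}" for s
  proof -
    have C0: "(\<lambda>n. C * (1 / real (Suc (k n)))) \<longlonglongrightarrow> 0"
      using tendsto_mult_right_zero[OF k0] .
    have bd: "norm (Z (k n) (max 0 (s - 1 / real (Suc (k n)))) - Z (k n) s) \<le> C * (1 / real (Suc (k n)))" for n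
    proof -
      define \<epsilon> where "\<epsilon> = 1 / real (Suc (k n))"
      have "0 < \<epsilon>" by (simp add: \<epsilon>_def)
      then have "max 0 (s - \<epsilon>) \<in> {0..T}" "\<bar>max 0 (s - \<epsilon>) - s\<bar> \<le> \<epsilon>" using s by auto
      with lip[of "max 0 (s - \<epsilon>)" s "k n"] s C show ?thesis
        unfolding \<epsilon>_def[symmetric] by (smt (verit) mult_left_mono)
    qed
    have "(\<lambda>n. Z (k n) (max 0 (s - 1 / real (Suc (k n)))) - Z (k n) s) \<longlonglongrightarrow> 0"
      by (rule Lim_null_comparison[OF _ C0], rule always_eventually, rule allI, rule bd)
    from tendsto_add[OF this ptw[OF s]] show ?thesis by simp
  qed
  have "z r = z 0 + integral {0..r} (\<lambda>s. G s (z s))" if r: "r \<in> {0..T}" for r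
  proof -
    have "(\<lambda>n. integral {0..r} (D (k n))) \<longlonglongrightarrow> integral {0..r} (\<lambda>s. G s (z s))"
    proof (rule dominated_convergence(2)[where h = "\<lambda>_. C"])
      show "D (k n) integrable_on {0..r}" for n using Di r by simp
      show "(\<lambda>_. C) integrable_on {0..r}" by (simp add: integrable_const_ivl)
      show "norm (D (k n) x) \<le> C" if "x \<in> {0..r}" for n x using Db that r by auto
      show "(\<lambda>n. D (k n) x) \<longlonglongrightarrow> G x (z x)" if "x \<in> {0..r}" for x
      proof -
        have x: "x \<in> {0..T}" using that r by auto
        then have "isCont (G x) (z x)"
          using continuous_on_field_snd[OF G x] continuous_on_eq_continuous_at[OF open_UNIV] by blast
        then show ?thesis
          unfolding D_def using del[OF x] by (rule isCont_tendsto_compose)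
      qed
    qed
    then have "(\<lambda>n. Z (k n) 0 + integral {0..r} (D (k n))) \<longlonglongrightarrow> z 0 + integral {0..r} (\<lambda>s. G s (z s))"
      using ptw[of 0] T by (intro tendsto_add) auto
    then have "(\<lambda>n. Z (k n) r) \<longlonglongrightarrow> z 0 + integral {0..r} (\<lambda>s. G s (z s))"
      unfolding ZD[OF r] .
    with ptw[OF r] show ?thesis using LIMSEQ_unique by blast
  qed
  moreover have "fst (z T) = 0"
    using tendsto_fst[OF ptw[of T]] T ZT by (simp add: LIMSEQ_const_iff)
  moreover have "snd (z 0) = 0"
    using tendsto_snd[OF ptw[of 0]] T Z0 by (simp add: LIMSEQ_const_iff)
  ultimately show thesis
    using that z by blast
qed

section \<open>Integrals of gradients\<close>

lemma integrable_lborel_bounded_support: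
  fixes f :: "'a::euclidean_space \<Rightarrow> 'b::{banach, second_countable_topology}"
  assumes "f \<in> borel_measurable borel" and "\<And>x. norm (f x) \<le> C"
    and "\<And>x. x \<notin> cball a R \<Longrightarrow> f x = 0"
  shows "integrable lborel f"
proof (rule integrableI_bounded_set[where A = "cball a R" and B = C])
  show "emeasure lborel (cball a R) < \<infinity>"
    using emeasure_bounded_finite[OF bounded_cball, of a R] by simp
qed (use assms in auto)

lemma lborel_integral_translation:
  fixes f :: "'a::euclidean_space \<Rightarrow> real"
  assumes "f \<in> borel_measurable borel"
  shows "(\<integral>x. f (c + x) \<partial>lborel) = (\<integral>x. f x \<partial>lborel)"
proof -
  have "(\<integral>x. f x \<partial>lborel) = (\<integral>x. f x \<partial>distr lborel borel ((+) c))"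
    by (simp add: lborel_distr_plus)
  also have "\<dots> = (\<integral>x. f (c + x) \<partial>lborel)"
    by (rule integral_distr) (use assms in auto)
  finally show ?thesis ..
qed

lemma lborel_integral_affine:
  fixes f :: "'a::euclidean_space \<Rightarrow> real"
  assumes [measurable]: "f \<in> borel_measurable borel" and c: "c \<noteq> 0"
  shows "(\<integral>x. f x \<partial>lborel) = \<bar>c\<bar> ^ DIM('a) * (\<integral>x. f (t + c *\<^sub>R x) \<partial>lborel)"
proof -
  have "(\<integral>x. f x \<partial>lborel) =
      (\<integral>x. f x \<partial>density (distr lborel borel (\<lambda>x. t + c *\<^sub>R x)) (\<lambda>_. ennreal (\<bar>c\<bar> ^ DIM('a))))"
    using lborel_affine[OF c, of t] by (simp add: ennreal_power)
  also have "\<dots> = (\<integral>x. \<bar>c\<bar> ^ DIM('a) *\<^sub>R f x \<partial>distr lborel borel (\<lambda>x. t + c *\<^sub>R x))"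
    by (rule integral_density) auto
  also have "\<dots> = (\<integral>x. \<bar>c\<bar> ^ DIM('a) *\<^sub>R f (t + c *\<^sub>R x) \<partial>lborel)"
    by (rule integral_distr) auto
  finally show ?thesis by simp
qed

lemma GDERIV_imp_DERIV_line:
  assumes "GDERIV F (x + h *\<^sub>R v) :> g"
  shows "((\<lambda>h. F (x + h *\<^sub>R v)) has_real_derivative g \<bullet> v) (at h)"
proof -
  have "((\<lambda>h. F (x + h *\<^sub>R v)) has_derivative (\<lambda>k. (k *\<^sub>R v) \<bullet> g)) (at h)"
  proof (rule has_derivative_compose[of "\<lambda>h. x + h *\<^sub>R v" "\<lambda>h. h *\<^sub>R v" h UNIV F])
    show "((\<lambda>h. x + h *\<^sub>R v) has_derivative (\<lambda>h. h *\<^sub>R v)) (at h)"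
      by (auto intro!: derivative_eq_intros)
    show "(F has_derivative (\<lambda>k. k \<bullet> g)) (at (x + h *\<^sub>R v))"
      using assms by (simp add: gderiv_def)
  qed
  moreover have "(\<lambda>k. (k *\<^sub>R v) \<bullet> g) = (*) (g \<bullet> v)"
    by (auto simp: inner_commute)
  ultimately show ?thesis
    by (simp add: has_field_derivative_def)
qed

text \<open>One statement serves a constant field \<open>v\<close> (translations) and
  \<open>v x = x - a\<close> (dilations). Along each segment the mean value theorem bounds the
  difference quotient by \<open>C\<close>, and \<open>supp\<close> confines it to a fixed ball, so a
  multiple of an indicator dominates. The point \<open>a\<close>, where \<open>F\<close> may fail to
  be differentiable, is a null set.\<close>

lemma integral_difference_quotients_tendsto:
  fixes F :: "'a::euclidean_space \<Rightarrow> real"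
  assumes [measurable]: "F \<in> borel_measurable borel" "v \<in> borel_measurable borel" "G \<in> borel_measurable borel"
    and der: "\<And>x h. x \<noteq> a \<Longrightarrow> 0 \<le> h \<Longrightarrow> h \<le> 1 \<Longrightarrow> GDERIV F (x + h *\<^sub>R v x) :> G (x + h *\<^sub>R v x)"
    and bd: "\<And>x h. x \<noteq> a \<Longrightarrow> 0 \<le> h \<Longrightarrow> h \<le> 1 \<Longrightarrow> \<bar>G (x + h *\<^sub>R v x) \<bullet> v x\<bar> \<le> C"
    and supp: "\<And>x h. x \<notin> cball a R \<Longrightarrow> 0 \<le> h \<Longrightarrow> h \<le> 1 \<Longrightarrow> F (x + h *\<^sub>R v x) = 0"
    and \<epsilon>: "\<And>n. 0 < \<epsilon> n" "\<And>n. \<epsilon> n \<le> 1" "\<epsilon> \<longlonglongrightarrow> 0"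
  shows "integrable lborel (\<lambda>x. G x \<bullet> v x)"
    "(\<lambda>n. \<integral>x. (F (x + \<epsilon> n *\<^sub>R v x) - F x) / \<epsilon> n \<partial>lborel) \<longlonglongrightarrow> (\<integral>x. G x \<bullet> v x \<partial>lborel)"
proof -
  define w where "w = (\<lambda>x. C * indicator (cball a R) x :: real)"
  have w: "integrable lborel w"
    unfolding w_def using emeasure_bounded_finite[OF bounded_cball, of a R] by simp
  have s_lim: "(\<lambda>n. (F (x + \<epsilon> n *\<^sub>R v x) - F x) / \<epsilon> n) \<longlonglongrightarrow> G x \<bullet> v x" if "x \<noteq> a" for x
  proof -
    have "((\<lambda>h. F (x + h *\<^sub>R v x)) has_real_derivative G x \<bullet> v x) (at 0)"
      using GDERIV_imp_DERIV_line[of F x 0 "v x" "G x"] der[of x 0] that by simp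
    then have "(\<lambda>h. (F (x + h *\<^sub>R v x) - F x) / h) \<midarrow>0\<rightarrow> G x \<bullet> v x"
      by (simp add: DERIV_def)
    moreover have "filterlim \<epsilon> (at 0) sequentially"
      by (rule filterlim_atI[OF \<epsilon>(3)]) (use \<epsilon>(1) in \<open>auto simp: less_imp_neq[symmetric]\<close>)
    ultimately show ?thesis
      by (rule filterlim_compose)
  qed
  have s_bd: "norm ((F (x + \<epsilon> n *\<^sub>R v x) - F x) / \<epsilon> n) \<le> w x" if x: "x \<noteq> a" for n x
  proof (cases "x \<in> cball a R")
    case False
    then show ?thesis
      using supp[of x 0] supp[of x "\<epsilon> n"] \<epsilon>(1,2)[of n] by (simp add: w_def less_imp_le)
  next
    case True
    have "((\<lambda>h. F (x + h *\<^sub>R v x)) has_real_derivative G (x + h *\<^sub>R v x) \<bullet> v x) (at h)"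
      if "0 \<le> h" "h \<le> \<epsilon> n" for h
      by (rule GDERIV_imp_DERIV_line[OF der[OF x]]) (use that \<epsilon>(2)[of n] in auto)
    from MVT2[OF \<epsilon>(1) this] obtain z where z: "0 < z" "z < \<epsilon> n"
      "F (x + \<epsilon> n *\<^sub>R v x) - F (x + 0 *\<^sub>R v x) = (\<epsilon> n - 0) * (G (x + z *\<^sub>R v x) \<bullet> v x)"
      by blast
    then have "(F (x + \<epsilon> n *\<^sub>R v x) - F x) / \<epsilon> n = G (x + z *\<^sub>R v x) \<bullet> v x"
      using \<epsilon>(1)[of n] by simp
    then show ?thesis
      using bd[OF x, of z] z \<epsilon>(2)[of n] True by (simp add: w_def)
  qed
  have AEa: "AE x in lborel. x \<noteq> a"
    by (rule AE_lborel_singleton)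
  have m: "(\<lambda>x. G x \<bullet> v x) \<in> borel_measurable lborel"
    "\<And>n. (\<lambda>x. (F (x + \<epsilon> n *\<^sub>R v x) - F x) / \<epsilon> n) \<in> borel_measurable lborel"
    by measurable
  have l: "AE x in lborel. (\<lambda>n. (F (x + \<epsilon> n *\<^sub>R v x) - F x) / \<epsilon> n) \<longlonglongrightarrow> G x \<bullet> v x"
    using AEa by eventually_elim (rule s_lim)
  have b: "AE x in lborel. norm ((F (x + \<epsilon> n *\<^sub>R v x) - F x) / \<epsilon> n) \<le> w x" for n
    using AEa by eventually_elim (rule s_bd)
  show "integrable lborel (\<lambda>x. G x \<bullet> v x)"
    by (rule integrable_dominated_convergence[OF m w l b])
  show "(\<lambda>n. \<integral>x. (F (x + \<epsilon> n *\<^sub>R v x) - F x) / \<epsilon> n \<partial>lborel) \<longlonglongrightarrow> (\<integral>x. G x \<bullet> v x \<partial>lborel)"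
    by (rule integral_dominated_convergence[OF m w l b])
qed

text \<open>Translation invariance makes the integrals of the difference quotients in direction \<open>e\<close>
  vanish.\<close>

lemma integral_gradient_eq_0:
  fixes F :: "'a::euclidean_space \<Rightarrow> real"
  assumes [measurable]: "G \<in> borel_measurable borel"
    and der: "\<And>x. GDERIV F x :> G x"
    and bd: "\<And>x. norm (G x) \<le> C"
    and supp: "\<And>x. x \<notin> cball a R \<Longrightarrow> F x = 0"
  shows "integrable lborel (\<lambda>x. G x \<bullet> e)" "(\<integral>x. G x \<bullet> e \<partial>lborel) = 0"
proof -
  define \<epsilon> where "\<epsilon> = (\<lambda>n. 1 / real (Suc n))"
  have \<epsilon>: "0 < \<epsilon> n" "\<epsilon> n \<le> 1" for n by (auto simp: \<epsilon>_def)
  have \<epsilon>0: "\<epsilon> \<longlonglongrightarrow> 0"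
    unfolding \<epsilon>_def using LIMSEQ_Suc[OF lim_inverse_n'] by simp
  have cont: "continuous_on UNIV F"
    using der unfolding gderiv_def by (meson has_derivative_continuous continuous_at_imp_continuous_on)
  then have F[measurable]: "F \<in> borel_measurable borel"
    by (rule borel_measurable_continuous_onI)
  obtain B where B: "\<And>x. norm (F x) \<le> B"
  proof -
    have "bounded (F ` cball a R)"
      by (intro compact_imp_bounded compact_continuous_image continuous_on_subset[OF cont]) auto
    then obtain B where "\<forall>x\<in>cball a R. norm (F x) \<le> B"
      by (auto simp: bounded_iff)
    then have "norm (F x) \<le> max B 0" for x
      using supp[of x] by (cases "x \<in> cball a R") (auto simp: le_max_iff_disj)
    then show thesis using that by blast
  qed
  have int: "integrable lborel F"
    by (rule integrable_lborel_bounded_support[OF F B supp])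
  have int': "integrable lborel (\<lambda>x. F (c + x))" for c
    by (rule integrable_lborel_bounded_support[where a = a and R = "R + norm c"])
      (use B in \<open>auto intro!: supp simp: dist_norm intro: order_trans[OF norm_triangle_le_diff]\<close>,
        smt (verit) add.commute diff_diff_eq2 norm_minus_commute norm_triangle_sub)
  have 0: "(\<integral>x. (F (x + \<epsilon> n *\<^sub>R e) - F x) / \<epsilon> n \<partial>lborel) = 0" for n
    using lborel_integral_translation[OF F, of "\<epsilon> n *\<^sub>R e"] int int'[of "\<epsilon> n *\<^sub>R e"]
    by (simp add: add.commute)
  have bd': "\<bar>G y \<bullet> e\<bar> \<le> C * norm e" for y
    using Cauchy_Schwarz_ineq2[of "G y" e] bd[of y] by (meson mult_right_mono norm_ge_zero order_trans)
  \<comment> \<open>A shift by at most \<open>e\<close> can carry a point into the support, so the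
    radius grows by \<open>norm e\<close>.\<close>
  have sp: "F (x + h *\<^sub>R e) = 0" if "x \<notin> cball a (R + norm e)" "0 \<le> h" "h \<le> 1" for x h
  proof (rule supp)
    have "norm (h *\<^sub>R e) \<le> norm e"
      using that by (simp add: mult_left_le_one_le)
    moreover have "norm (x - a) \<le> norm (x + h *\<^sub>R e - a) + norm (h *\<^sub>R e)"
      using norm_triangle_ineq4[of "x + h *\<^sub>R e - a" "h *\<^sub>R e"] by simp
    ultimately show "x + h *\<^sub>R e \<notin> cball a R"
      using that by (auto simp: dist_norm norm_minus_commute)
  qed
  note lims = integral_difference_quotients_tendsto[where v = "\<lambda>_. e" and a = a and C = "C * norm e"
      and R = "R + norm e" and \<epsilon> = \<epsilon> and F = F and G = G, OF F _ assms(1) der bd' sp \<epsilon> \<epsilon>0]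
  show "integrable lborel (\<lambda>x. G x \<bullet> e)"
    by (rule lims(1)) auto
  show "(\<integral>x. G x \<bullet> e \<partial>lborel) = 0"
    using lims(2) unfolding 0 by (simp add: LIMSEQ_const_iff)
qed

text \<open>The same argument with dilations about \<open>a\<close>. Rays never meet the exceptional point \<open>a\<close>.\<close>

lemma integral_euler_derivative:
  fixes F :: "'a::euclidean_space \<Rightarrow> real"
  assumes F[measurable]: "F \<in> borel_measurable borel" and G[measurable]: "G \<in> borel_measurable borel"
    and der: "\<And>x. x \<noteq> a \<Longrightarrow> GDERIV F x :> G x"
    and F_bd: "\<And>x. \<bar>F x\<bar> \<le> B"
    and bd: "\<And>x. \<bar>G x \<bullet> (x - a)\<bar> \<le> C"
    and supp: "\<And>x. x \<notin> cball a R \<Longrightarrow> F x = 0"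
  shows "integrable lborel F" "integrable lborel (\<lambda>x. G x \<bullet> (x - a))"
    "(\<integral>x. G x \<bullet> (x - a) \<partial>lborel) = - (real DIM('a) * (\<integral>x. F x \<partial>lborel))"
proof -
  define \<epsilon> where "\<epsilon> = (\<lambda>n. 1 / real (Suc n))"
  have \<epsilon>: "0 < \<epsilon> n" "\<epsilon> n \<le> 1" for n by (auto simp: \<epsilon>_def)
  have \<epsilon>0: "\<epsilon> \<longlonglongrightarrow> 0"
    unfolding \<epsilon>_def using LIMSEQ_Suc[OF lim_inverse_n'] by simp
  show int: "integrable lborel F"
    by (rule integrable_lborel_bounded_support[OF F _ supp]) (use F_bd in auto)
  have shift: "x + h *\<^sub>R (x - a) - a = (1 + h) *\<^sub>R (x - a)" for x h
    by (simp add: algebra_simps)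
  have ne: "x + h *\<^sub>R (x - a) \<noteq> a" if "x \<noteq> a" "0 \<le> h" for x h
    using shift[of x h] that by (metis add_nonneg_pos diff_self eq_iff_diff_eq_0 less_irrefl
        add.commute scaleR_eq_0_iff zero_less_one)
  have out: "x + h *\<^sub>R (x - a) \<notin> cball a R" if "x \<notin> cball a R" "0 \<le> h" for x h
  proof -
    have "dist a (x + h *\<^sub>R (x - a)) = (1 + h) * dist a x"
      using that shift[of x h] by (simp add: dist_norm norm_minus_commute[of a])
    also have "\<dots> \<ge> dist a x"
      using that by (simp add: algebra_simps)
    finally show ?thesis using that by auto
  qed
  have der': "GDERIV F (x + h *\<^sub>R (x - a)) :> G (x + h *\<^sub>R (x - a))" if "x \<noteq> a" "0 \<le> h" "h \<le> 1" for x h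
    by (rule der[OF ne]) (use that in auto)
  \<comment> \<open>The hypothesis bounds G y paired with y - a at the moved point y. There y - a =
    (1 + h) (x - a), so passing to x - a only decreases the absolute value.\<close>
  have bd': "\<bar>G (x + h *\<^sub>R (x - a)) \<bullet> (x - a)\<bar> \<le> C" if "x \<noteq> a" "0 \<le> h" "h \<le> 1" for x h
  proof -
    have "\<bar>G (x + h *\<^sub>R (x - a)) \<bullet> (x - a)\<bar> \<le> (1 + h) * \<bar>G (x + h *\<^sub>R (x - a)) \<bullet> (x - a)\<bar>"
      using that by (simp add: algebra_simps)
    also have "\<dots> = \<bar>G (x + h *\<^sub>R (x - a)) \<bullet> (x + h *\<^sub>R (x - a) - a)\<bar>"
      using that unfolding shift by (simp add: abs_mult)
    finally show ?thesis using bd order_trans by blast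
  qed
  have int': "integrable lborel (\<lambda>x. F (x + \<epsilon> n *\<^sub>R (x - a)))" for n
    by (rule integrable_lborel_bounded_support[where a = a and R = R and C = B])
      (use F_bd supp out \<epsilon>(1)[of n] in \<open>auto simp: less_imp_le\<close>)
  \<comment> \<open>The dilation by 1 + \<epsilon> scales the integral by (1 + \<epsilon>)^(-n) with
    n the dimension; the derivative of this factor at \<epsilon> = 0 is the -n of the
    conclusion.\<close>
  have D: "(\<integral>x. (F (x + \<epsilon> n *\<^sub>R (x - a)) - F x) / \<epsilon> n \<partial>lborel) =
      ((1 + \<epsilon> n) powi (- int DIM('a)) - 1) / \<epsilon> n * (\<integral>x. F x \<partial>lborel)" for n
  proof -
    have "x + \<epsilon> n *\<^sub>R (x - a) = - \<epsilon> n *\<^sub>R a + (1 + \<epsilon> n) *\<^sub>R x" for x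
      by (simp add: algebra_simps)
    moreover have "(\<integral>x. F x \<partial>lborel) = (1 + \<epsilon> n) ^ DIM('a) * (\<integral>x. F (- \<epsilon> n *\<^sub>R a + (1 + \<epsilon> n) *\<^sub>R x) \<partial>lborel)"
      using lborel_integral_affine[OF F, of "1 + \<epsilon> n" "- \<epsilon> n *\<^sub>R a"] \<epsilon>(1)[of n] by simp
    ultimately have "(\<integral>x. F (x + \<epsilon> n *\<^sub>R (x - a)) \<partial>lborel) = (1 + \<epsilon> n) powi (- int DIM('a)) * (\<integral>x. F x \<partial>lborel)"
      using \<epsilon>(1)[of n] by (simp add: power_int_minus field_simps)
    then show ?thesis
      using int int'[of n] by (simp add: diff_divide_distrib left_diff_distrib)
  qed
  have "((\<lambda>h::real. (1 + h) powi (- int DIM('a))) has_real_derivative - real DIM('a)) (at 0)"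
    by (auto intro!: derivative_eq_intros)
  then have "(\<lambda>h::real. ((1 + h) powi (- int DIM('a)) - 1) / h) \<midarrow>0\<rightarrow> - real DIM('a)"
    by (simp add: DERIV_def)
  moreover have "filterlim \<epsilon> (at 0) sequentially"
    by (rule filterlim_atI[OF \<epsilon>0]) (use \<epsilon>(1) in \<open>auto simp: less_imp_neq[symmetric]\<close>)
  ultimately have "(\<lambda>n. ((1 + \<epsilon> n) powi (- int DIM('a)) - 1) / \<epsilon> n) \<longlonglongrightarrow> - real DIM('a)"
    by (rule filterlim_compose)
  from tendsto_mult_right[OF this]
  have lim1: "(\<lambda>n. ((1 + \<epsilon> n) powi (- int DIM('a)) - 1) / \<epsilon> n * (\<integral>x. F x \<partial>lborel)) \<longlonglongrightarrow>
      - real DIM('a) * (\<integral>x. F x \<partial>lborel)" .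
  note lims = integral_difference_quotients_tendsto[where v = "\<lambda>x. x - a" and a = a and C = C
      and R = R and \<epsilon> = \<epsilon> and F = F and G = G, OF F _ G der' bd' supp[OF out] \<epsilon> \<epsilon>0]
  show "integrable lborel (\<lambda>x. G x \<bullet> (x - a))"
    by (rule lims(1)) auto
  have "(\<lambda>n. ((1 + \<epsilon> n) powi (- int DIM('a)) - 1) / \<epsilon> n * (\<integral>x. F x \<partial>lborel)) \<longlonglongrightarrow> (\<integral>x. G x \<bullet> (x - a) \<partial>lborel)"
    using lims(2) unfolding D by simp
  from LIMSEQ_unique[OF this lim1]
  show "(\<integral>x. G x \<bullet> (x - a) \<partial>lborel) = - (real DIM('a) * (\<integral>x. F x \<partial>lborel))"
    by simp
qed

section \<open>Test functions and integrals over balls\<close>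

lemma test_function_GDERIV:
  assumes "\<phi> \<in> test_functions \<Omega>"
  shows "GDERIV \<phi> x :> grad \<phi> x"
proof -
  have "C_k (Suc 0) \<phi>"
    using assms unfolding test_functions_def by blast
  then have "\<phi> differentiable (at x)"
    by (auto simp: differentiable_on_def)
  then have d: "(\<phi> has_derivative frechet_derivative \<phi> (at x)) (at x)"
    by (simp add: frechet_derivative_works)
  have "frechet_derivative \<phi> (at x) h = h \<bullet> grad \<phi> x" for h
  proof -
    have "frechet_derivative \<phi> (at x) h = frechet_derivative \<phi> (at x) (\<Sum>i\<in>Basis. (h \<bullet> i) *\<^sub>R i)"
      by (simp add: euclidean_representation)
    also have "\<dots> = (\<Sum>i\<in>Basis. (h \<bullet> i) * frechet_derivative \<phi> (at x) i)"
      using has_derivative_linear[OF d] by (simp add: linear_sum linear_scale)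
    also have "\<dots> = h \<bullet> grad \<phi> x"
      by (simp add: grad_def partial_deriv_def inner_sum_right mult.commute)
    finally show ?thesis .
  qed
  then have "frechet_derivative \<phi> (at x) = (\<lambda>h. h \<bullet> grad \<phi> x)"
    by blast
  with d show ?thesis
    by (simp add: gderiv_def)
qed

lemma grad_inner_Basis: "i \<in> Basis \<Longrightarrow> grad \<phi> x \<bullet> i = partial_deriv i \<phi> x"
  by (simp add: grad_def inner_sum_left inner_Basis if_distrib sum.delta cong: if_cong)

lemma test_function_continuous:
  assumes "\<phi> \<in> test_functions \<Omega>"
  shows "continuous_on UNIV \<phi>" "continuous_on UNIV (grad \<phi>)"
proof -
  have "C_k 0 \<phi>" "C_k (Suc 0) \<phi>"
    using assms unfolding test_functions_def by blast+
  then show "continuous_on UNIV \<phi>" "continuous_on UNIV (grad \<phi>)"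
    by (auto simp: grad_def[abs_def] intro!: continuous_intros)
qed

text \<open>The support is closed and contained in \<Omega>, so near a point outside \<Omega>,
  boundary points included, the function vanishes on a whole neighbourhood; this forces the gradient
  to vanish too.\<close>

lemma test_function_eq_0:
  assumes "\<phi> \<in> test_functions \<Omega>" "x \<notin> \<Omega>"
  shows "\<phi> x = 0" "grad \<phi> x = 0"
proof -
  let ?S = "closure {x. \<phi> x \<noteq> 0}"
  have x: "x \<in> - ?S" and op: "open (- ?S)"
    using assms unfolding test_functions_def by auto
  have z: "\<phi> y = 0" if "y \<in> - ?S" for y
    using that closure_subset[of "{x. \<phi> x \<noteq> 0}"] by auto
  then show "\<phi> x = 0" using x by blast
  have "((\<lambda>_. 0) has_derivative (\<lambda>h. h \<bullet> grad \<phi> x)) (at x)"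
    by (rule has_derivative_transform_within_open[OF test_function_GDERIV[OF assms(1), unfolded gderiv_def] op x z])
  from has_derivative_unique[OF this has_derivative_const]
  have "(\<lambda>h. h \<bullet> grad \<phi> x) = (\<lambda>h. 0)" .
  then show "grad \<phi> x = 0"
    by (metis inner_eq_zero_iff)
qed

lemma test_function_bounded:
  assumes "\<phi> \<in> test_functions \<Omega>"
  obtains B where "0 \<le> B" "\<And>x. \<bar>\<phi> x\<bar> \<le> B" "\<And>x. norm (grad \<phi> x) \<le> B"
proof -
  let ?S = "closure {x. \<phi> x \<noteq> 0}"
  \<comment> \<open>Regarding \<phi> as a test function on its own support lets the vanishing lemma
    act everywhere outside a compact set.\<close>
  have S: "compact ?S" and T: "\<phi> \<in> test_functions ?S"
    using assms unfolding test_functions_def by auto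
  have "bounded (\<phi> ` ?S)" "bounded (grad \<phi> ` ?S)"
    using test_function_continuous[OF T] S
    by (meson compact_continuous_image compact_imp_bounded continuous_on_subset subset_UNIV)+
  then obtain B1 B2 where B: "\<forall>x\<in>?S. \<bar>\<phi> x\<bar> \<le> B1" "\<forall>x\<in>?S. norm (grad \<phi> x) \<le> B2"
    by (auto simp: bounded_iff)
  have "\<bar>\<phi> x\<bar> \<le> max 0 (max B1 B2) \<and> norm (grad \<phi> x) \<le> max 0 (max B1 B2)" for x
  proof (cases "x \<in> ?S")
    case True
    with B have "\<bar>\<phi> x\<bar> \<le> B1" "norm (grad \<phi> x) \<le> B2" by blast+
    then show ?thesis by linarith
  next
    case False
    then show ?thesis using test_function_eq_0[OF T False] by simp
  qed
  then show thesis
    using that[of "max 0 (max B1 B2)"] by simp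
qed

section \<open>Passing between Lebesgue measure on a ball and \<open>lborel\<close>\<close>

lemma measurable_lebesgue_on_borel:
  "f \<in> borel_measurable borel \<Longrightarrow> f \<in> borel_measurable (lebesgue_on S)"
  by (intro measurable_restrict_space1 measurable_completion) simp

lemma set_integrable_lebesgue_bounded:
  fixes f :: "'a::euclidean_space \<Rightarrow> 'b::euclidean_space"
  assumes [measurable]: "f \<in> borel_measurable borel" "S \<in> sets borel"
    and S: "S \<subseteq> cball a R" and bd: "\<And>x. x \<in> S \<Longrightarrow> norm (f x) \<le> C"
  shows "set_integrable lebesgue S f"
proof -
  have "integrable lborel (\<lambda>x. indicator S x *\<^sub>R f x)"
    by (rule integrable_lborel_bounded_support[where a = a and R = R and C = "max C 0"])
      (use S bd in \<open>auto simp: indicator_def le_max_iff_disj\<close>)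
  then show ?thesis
    unfolding set_integrable_def by (subst integrable_completion) auto
qed

lemma integrable_lebesgue_on_iff:
  "S \<in> sets lebesgue \<Longrightarrow> integrable (lebesgue_on S) f \<longleftrightarrow> set_integrable lebesgue S f"
  for f :: "'a::euclidean_space \<Rightarrow> 'b::euclidean_space"
  by (simp add: integrable_restrict_space set_integrable_def)

lemma integral_lebesgue_on_eq_lborel:
  fixes f :: "'a::euclidean_space \<Rightarrow> real"
  assumes [measurable]: "f \<in> borel_measurable borel" "S \<in> sets borel" and "\<And>x. x \<notin> S \<Longrightarrow> f x = 0"
  shows "(\<integral>x. f x \<partial>lebesgue_on S) = (\<integral>x. f x \<partial>lborel)"
proof -
  have "(\<integral>x. f x \<partial>lebesgue_on S) = (\<integral>x. indicator S x *\<^sub>R f x \<partial>lebesgue)"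
    by (rule integral_restrict_space) auto
  also have "(\<lambda>x. indicator S x *\<^sub>R f x) = f"
    using assms(3) by (auto simp: indicator_def fun_eq_iff)
  also have "(\<integral>x. f x \<partial>lebesgue) = (\<integral>x. f x \<partial>lborel)"
    by (rule integral_completion) simp
  finally show ?thesis .
qed

section \<open>Calculus of radial functions\<close>

lemma DERIV_integral_from_0:
  assumes g: "continuous_on {0..} g"
  shows "0 < r \<Longrightarrow> ((\<lambda>r. integral {0..r} g) has_real_derivative g r) (at r)"
    and "((\<lambda>r. integral {0..r} g) has_real_derivative g 0) (at 0 within {0..})"
proof -
  have *: "((\<lambda>r. integral {0..r} g) has_real_derivative g r) (at r within {0..r + 1})" if "0 \<le> r" for r
    by (rule integral_has_real_derivative) (use that in \<open>auto intro: continuous_on_subset[OF g]\<close>)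
  show "((\<lambda>r. integral {0..r} g) has_real_derivative g r) (at r)" if "0 < r"
    using *[of r] that by (simp add: at_within_Icc_at)
  show "((\<lambda>r. integral {0..r} g) has_real_derivative g 0) (at 0 within {0..})"
    using *[of 0] by (simp add: at_within_Icc_at_right at_within_Ici_at_right)
qed

lemma continuous_on_integral_from_0:
  assumes g: "continuous_on {0..} (g :: real \<Rightarrow> real)"
  shows "continuous_on {0..} (\<lambda>r. integral {0..r} g)"
  unfolding continuous_on_eq_continuous_within
proof safe
  fix r :: real assume "0 \<le> r"
  then show "continuous (at r within {0..}) (\<lambda>r. integral {0..r} g)"
    using DERIV_continuous[OF DERIV_integral_from_0(2)[OF g]] DERIV_isCont[OF DERIV_integral_from_0(1)[OF g, of r]]
    by (cases "r = 0") (simp_all add: continuous_at_imp_continuous_at_within)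
qed

lemma GDERIV_radial:
  fixes x0 :: "'a::euclidean_space"
  assumes "x \<noteq> x0" "(u has_real_derivative d) (at (norm (x - x0)))"
  shows "GDERIV (\<lambda>y. u (norm (y - x0))) x :> (d / norm (x - x0)) *\<^sub>R (x - x0)"
proof -
  have "GDERIV norm (x - x0) :> sgn (x - x0)"
    using assms by (intro GDERIV_norm) simp
  then have "((\<lambda>y. norm (y - x0)) has_derivative (\<lambda>h. h \<bullet> sgn (x - x0))) (at x)"
    unfolding gderiv_def
    by (intro has_derivative_compose[of "\<lambda>y. y - x0" "\<lambda>h. h" x UNIV norm]) (auto intro!: derivative_eq_intros)
  then have "GDERIV (\<lambda>y. norm (y - x0)) x :> sgn (x - x0)"
    by (simp add: gderiv_def)
  from GDERIV_DERIV_compose[OF this assms(2)] show ?thesis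
    by (simp add: sgn_div_norm divide_inverse)
qed

lemma GDERIV_radial_center:
  fixes x0 :: "'a::euclidean_space"
  assumes "(u has_real_derivative 0) (at 0 within {0..})"
  shows "GDERIV (\<lambda>y. u (norm (y - x0))) x0 :> 0"
proof -
  have "((\<lambda>r. (u r - u 0) / r) \<longlongrightarrow> 0) (at_right 0)"
    using assms by (simp add: has_field_derivative_iff at_within_Ici_at_right)
  moreover have "filterlim (\<lambda>y. norm (y - x0)) (at_right 0) (at x0)"
    unfolding filterlim_at
  proof
    show "\<forall>\<^sub>F y in at x0. norm (y - x0) \<in> {0<..} \<and> norm (y - x0) \<noteq> 0"
      by (auto simp: eventually_at intro!: exI[of _ 1])
    show "((\<lambda>y. norm (y - x0)) \<longlongrightarrow> 0) (at x0)"
      by (auto intro!: tendsto_eq_intros)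
  qed
  ultimately have "((\<lambda>y. (u (norm (y - x0)) - u 0) / norm (y - x0)) \<longlongrightarrow> 0) (at x0)"
    by (rule filterlim_compose)
  then have "((\<lambda>y. \<bar>(u (norm (y - x0)) - u 0) / norm (y - x0)\<bar>) \<longlongrightarrow> 0) (at x0)"
    by (rule tendsto_rabs_zero)
  then show ?thesis
    by (simp add: gderiv_def has_derivative_iff_norm abs_divide)
qed

section \<open>Bounds for essential suprema\<close>

lemma Linf_norm_le:
  fixes g :: "'a::euclidean_space \<Rightarrow> 'b::euclidean_space"
  assumes [measurable]: "g \<in> borel_measurable borel" and bd: "\<And>x. x \<in> S \<Longrightarrow> norm (g x) \<le> B"
  shows "Linf_norm S g \<le> ereal B"
  unfolding Linf_norm_def
proof (rule esssup_I)
  show "(\<lambda>x. ereal (norm (g x))) \<in> borel_measurable (lebesgue_on S)"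
    by (rule measurable_lebesgue_on_borel) measurable
  show "AE x in lebesgue_on S. ereal (norm (g x)) \<le> ereal B"
    by (rule AE_I2) (use bd in \<open>auto simp: space_restrict_space\<close>)
qed

text \<open>A nonempty open set is not negligible, so an essential supremum cannot undercut a lower
  bound valid on it.\<close>

lemma Linf_norm_ge:
  fixes g :: "'a::euclidean_space \<Rightarrow> 'b::euclidean_space"
  assumes T: "open T" "T \<noteq> {}" "T \<subseteq> S" and S: "S \<in> sets lebesgue"
    and bd: "\<And>x. x \<in> T \<Longrightarrow> d \<le> norm (g x)"
  shows "ereal d \<le> Linf_norm S g"
proof (rule ccontr)
  assume "\<not> ?thesis"
  then have less: "Linf_norm S g < ereal d" by simp
  have "AE x in lebesgue_on S. ereal (norm (g x)) \<le> Linf_norm S g"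
    unfolding Linf_norm_def by (rule esssup_AE)
  then have "AE x in lebesgue_on S. x \<notin> T"
  proof eventually_elim
    case (elim x)
    from order_le_less_trans[OF elim less] show ?case
      using bd[of x] by auto
  qed
  then have "AE x in lebesgue. x \<in> S \<longrightarrow> x \<notin> T"
    using S by (subst (asm) AE_restrict_space_iff) auto
  then have "AE x in lebesgue. x \<notin> T"
    by eventually_elim (use T in auto)
  then have "emeasure lebesgue T = 0"
    using T(1) by (subst (asm) AE_iff_measurable[where N = T]) auto
  then have "negligible T"
    using T(1) by (auto simp: negligible_iff_null_sets null_sets_def)
  then show False
    using open_not_negligible[OF T(1,2)] by simp
qed

section \<open>Radial weak solutions\<close>

text \<open>The outer radius factors out of the kernel, at r = 0 as well by the convention for
  division by zero. Kernel integrals thereby become a mass divided by r^(N-1).\<close>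

lemma integral_K_eq:
  "integral {a..c} (\<lambda>s. K N b s r) = integral {a..c} (\<lambda>s. s ^ (N - 1) * b s) / r ^ (N - 1)"
proof -
  have "(\<lambda>s. K N b s r) = (\<lambda>s. (s ^ (N - 1) * b s) / r ^ (N - 1))"
    by (simp add: K_def power_divide)
  then show ?thesis
    by simp
qed

text \<open>The source lives on all of [0,\<infinity>), so that the profile extends differentiably
  across the sphere and the ball enters only through the test functions.\<close>

locale radial_source =
  fixes N :: nat and p :: real and b :: "real \<Rightarrow> real"
  assumes N: "1 < N" and p: "1 < p"
    and b_cont: "continuous_on {0..} b" and b_nonneg: "\<And>r. 0 \<le> r \<Longrightarrow> 0 \<le> b r"
begin

text \<open>One integration of (r^(N-1) |u'|^(p-1))' = r^(N-1) b gives \<open>flux\<close>; dividing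
  by r^(N-1) and inverting the power gives \<open>slope\<close>, which is -u'.\<close>

definition flux :: "real \<Rightarrow> real" where
  "flux r = integral {0..r} (\<lambda>s. s ^ (N - 1) * b s)"

definition slope :: "real \<Rightarrow> real" where
  "slope r = phi_q p (integral {0..r} (\<lambda>s. K N b s r))"

lemma density_cont: "continuous_on {0..} (\<lambda>s. s ^ (N - 1) * b s)"
  by (intro continuous_intros b_cont)

lemma flux_cont: "continuous_on {0..} flux"
  unfolding flux_def[abs_def] by (rule continuous_on_integral_from_0[OF density_cont])

lemma flux_nonneg: "0 \<le> flux r"
  unfolding flux_def
  by (rule integral_nonneg[OF integrable_continuous_real])
    (auto intro!: continuous_on_subset[OF density_cont[simplified]] b_nonneg mult_nonneg_nonneg)

text \<open>The order r^N exceeds by one the power r^(N-1) dividing the flux in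
  \<open>slope\<close>. Hence the slope tends to 0 at the centre, while
  \<open>flux r / r ^ N\<close> stays bounded.\<close>

lemma flux_le:
  assumes "0 \<le> r" "\<And>s. 0 \<le> s \<Longrightarrow> s \<le> r \<Longrightarrow> b s \<le> C"
  shows "flux r \<le> C * r ^ N"
proof -
  have "norm (integral {0..r} (\<lambda>s. s ^ (N - 1) * b s)) \<le> (r ^ (N - 1) * C) * (r - 0)"
  proof (rule integral_bound)
    show "norm (s ^ (N - 1) * b s) \<le> r ^ (N - 1) * C" if "s \<in> {0..r}" for s
      using that assms b_nonneg[of s] by (auto simp: abs_mult power_abs intro!: mult_mono power_mono)
  qed (use assms in \<open>auto intro!: continuous_on_subset[OF density_cont[simplified]]\<close>)
  also have "r ^ (N - 1) * C * (r - 0) = C * r ^ N"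
    using power_Suc[of r "N - 1"] N by (simp add: mult_ac)
  finally show ?thesis by (simp add: flux_def)
qed

lemma slope_eq: "slope r = phi_q p (flux r / r ^ (N - 1))"
  by (simp add: slope_def flux_def integral_K_eq)

lemma slope_nonneg: "0 \<le> slope r"
  by (simp add: slope_def phi_q_def)

lemma slope_0: "slope 0 = 0"
  by (simp add: slope_def phi_q_def)

lemma slope_powr: "0 \<le> r \<Longrightarrow> slope r powr (p - 1) = flux r / r ^ (N - 1)"
  using p flux_nonneg[of r] by (simp add: slope_eq phi_q_def powr_powr)

lemma mean_flux_cont: "continuous_on {0..} (\<lambda>r. flux r / r ^ (N - 1))"
  unfolding continuous_on_eq_continuous_within
proof safe
  fix r :: real assume r: "0 \<le> r"
  show "continuous (at r within {0..}) (\<lambda>r. flux r / r ^ (N - 1))"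
  proof (cases "r = 0")
    case False
    then show ?thesis
      using flux_cont r by (intro continuous_intros) (auto simp: continuous_on_eq_continuous_within)
  next
    case True
    have "bounded (b ` {0..1})"
      by (intro compact_imp_bounded compact_continuous_image continuous_on_subset[OF b_cont]) auto
    then obtain C where C: "\<And>s. 0 \<le> s \<Longrightarrow> s \<le> 1 \<Longrightarrow> b s \<le> C"
      by (auto simp: bounded_iff) (meson abs_le_D1 atLeastAtMost_iff)
    have bd: "norm (flux s / s ^ (N - 1)) \<le> C * s" if "0 \<le> s" "s < 1" for s
    proof (cases "s = 0")
      case True
      then show ?thesis using N by (simp add: power_0_left)
    next
      case False
      have "flux s \<le> C * s ^ N"
        by (rule flux_le) (use that C in auto)
      also have "\<dots> = C * s * s ^ (N - 1)"
        using power_Suc[of s "N - 1"] N by simp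
      finally show ?thesis
        using False that flux_nonneg[of s] by (simp add: divide_le_eq abs_of_nonneg)
    qed
    have "((\<lambda>s. flux s / s ^ (N - 1)) \<longlongrightarrow> 0) (at 0 within {0..})"
    proof (rule Lim_null_comparison)
      show "\<forall>\<^sub>F s in at 0 within {0..}. norm (flux s / s ^ (N - 1)) \<le> C * s"
        unfolding eventually_at by (rule exI[of _ 1]) (use bd in \<open>auto simp: dist_real_def\<close>)
      show "((\<lambda>s. C * s) \<longlongrightarrow> 0) (at 0 within {0..})"
        by (auto intro!: tendsto_eq_intros)
    qed
    then show ?thesis
      using True N by (simp add: continuous_within power_0_left)
  qed
qed

lemma slope_cont: "continuous_on {0..} slope"
  unfolding slope_eq[abs_def] phi_q_def
  by (rule continuous_on_powr') (use mean_flux_cont p flux_nonneg in \<open>auto intro!: continuous_intros\<close>)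

end

text \<open>Written as a difference of integrals from 0, the profile keeps its meaning for r >
  \<rho>. The integral over {r..\<rho>} would be 0 there and could put a kink at the sphere.\<close>

locale radial_solution = radial_source +
  fixes x0 :: "'a::euclidean_space" and \<rho> :: real and u :: "real \<Rightarrow> real"
  assumes dim: "N = DIM('a)" and \<rho>: "0 < \<rho>"
    and u: "\<And>r. 0 \<le> r \<Longrightarrow> u r = integral {0..\<rho>} slope - integral {0..r} slope"
begin

definition U :: "'a \<Rightarrow> real" where "U x = u (norm (x - x0))"

definition DU :: "'a \<Rightarrow> 'a" where
  "DU x = (- slope (norm (x - x0)) / norm (x - x0)) *\<^sub>R (x - x0)"

lemma u_deriv: "0 < r \<Longrightarrow> (u has_real_derivative - slope r) (at r)"
  by (rule has_field_derivative_transform_within_open[where S = "{0<..}" and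
        f = "\<lambda>r. integral {0..\<rho>} slope - integral {0..r} slope"])
    (use u DERIV_integral_from_0(1)[OF slope_cont] in \<open>auto intro!: derivative_eq_intros\<close>)

lemma u_deriv_0: "(u has_real_derivative 0) (at 0 within {0..})"
  by (rule has_field_derivative_transform_within[where d = 1 and
        f = "\<lambda>r. integral {0..\<rho>} slope - integral {0..r} slope"])
    (use u DERIV_integral_from_0(2)[OF slope_cont] slope_0 in \<open>auto intro!: derivative_eq_intros\<close>)

lemma u_cont: "continuous_on {0..} u"
  by (rule continuous_on_eq[where f = "\<lambda>r. integral {0..\<rho>} slope - integral {0..r} slope"])
    (use u continuous_on_integral_from_0[OF slope_cont] in \<open>auto intro!: continuous_intros\<close>)

lemma GDERIV_U: "GDERIV U x :> DU x"
proof (cases "x = x0")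
  case True
  then show ?thesis
    using GDERIV_radial_center[OF u_deriv_0, of x0] by (simp add: U_def[abs_def] DU_def)
next
  case False
  then show ?thesis
    using GDERIV_radial[OF False u_deriv] by (simp add: U_def[abs_def] DU_def)
qed

lemma norm_DU: "norm (DU x) = slope (norm (x - x0))"
  using slope_nonneg slope_0 by (cases "x = x0") (auto simp: DU_def)

lemma continuous_radial: "continuous_on {0..} g \<Longrightarrow> continuous_on UNIV (\<lambda>x::'a. g (norm (x - x0)))"
  by (rule continuous_on_compose2[of "{0..}" g]) (auto intro!: continuous_intros)

lemma measurable_radial[measurable]:
  "continuous_on {0..} g \<Longrightarrow> (\<lambda>x::'a. g (norm (x - x0)) :: real) \<in> borel_measurable borel"
  by (intro borel_measurable_continuous_onI continuous_radial)

lemma U_cont: "continuous_on UNIV U"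
  unfolding U_def[abs_def] by (rule continuous_radial[OF u_cont])

lemma measurable_U[measurable]: "U \<in> borel_measurable borel"
  by (intro borel_measurable_continuous_onI U_cont)

lemma measurable_DU[measurable]: "DU \<in> borel_measurable borel"
proof -
  have [measurable]: "(\<lambda>x. slope (norm (x - x0))) \<in> borel_measurable borel"
    by (rule measurable_radial[OF slope_cont])
  show ?thesis unfolding DU_def[abs_def] by measurable
qed

lemma radial_bounded:
  assumes "continuous_on {0..} (g :: real \<Rightarrow> real)"
  obtains B where "0 \<le> B" "\<And>x::'a. x \<in> ball x0 \<rho> \<Longrightarrow> \<bar>g (norm (x - x0))\<bar> \<le> B"
proof -
  have "bounded (g ` {0..\<rho>})"
    by (intro compact_imp_bounded compact_continuous_image continuous_on_subset[OF assms]) auto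
  then obtain B where "\<forall>r\<in>{0..\<rho>}. \<bar>g r\<bar> \<le> B"
    unfolding bounded_iff by auto
  then have B: "\<bar>g r\<bar> \<le> B" if "r \<in> {0..\<rho>}" for r
    using that by blast
  from B[of 0] have "0 \<le> B" using \<rho> by (auto intro: order_trans[OF abs_ge_zero])
  moreover have "\<bar>g (norm (x - x0))\<bar> \<le> B" if "x \<in> ball x0 \<rho>" for x
    using that by (intro B) (auto simp: dist_norm norm_minus_commute)
  ultimately show thesis using that by blast
qed

lemma integrable_ball:
  fixes f :: "'a \<Rightarrow> 'c::euclidean_space"
  assumes "f \<in> borel_measurable borel" "\<And>x. x \<in> ball x0 \<rho> \<Longrightarrow> norm (f x) \<le> C"
  shows "integrable (lebesgue_on (ball x0 \<rho>)) f"
  unfolding integrable_lebesgue_on_iff[OF lmeasurable_ball[THEN fmeasurableD]]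
  by (rule set_integrable_lebesgue_bounded[OF assms(1) _ ball_subset_cball assms(2)]) auto

lemma in_W1p_U: "in_W1p p (ball x0 \<rho>) U DU"
proof -
  obtain B1 where B1: "0 \<le> B1" "\<And>x. x \<in> ball x0 \<rho> \<Longrightarrow> \<bar>U x\<bar> \<le> B1"
    using radial_bounded[OF u_cont] unfolding U_def by blast
  obtain B2 where B2: "0 \<le> B2" "\<And>x. x \<in> ball x0 \<rho> \<Longrightarrow> norm (DU x) \<le> B2"
    using radial_bounded[OF slope_cont] slope_nonneg unfolding norm_DU by (metis abs_of_nonneg)
  have "in_Lp p (ball x0 \<rho>) U"
    unfolding in_Lp_def using B1 p
    by (auto intro!: measurable_lebesgue_on_borel integrable_ball[where C = "B1 powr p"] powr_mono2)
  moreover have "in_Lp p (ball x0 \<rho>) DU"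
    unfolding in_Lp_def using B2 p
    by (auto intro!: measurable_lebesgue_on_borel integrable_ball[where C = "B2 powr p"] powr_mono2)
  moreover have "U absolutely_integrable_on C" "DU absolutely_integrable_on C"
    if "compact C" "C \<subseteq> ball x0 \<rho>" for C
    by (rule set_integrable_lebesgue_bounded[where a = x0 and R = \<rho> and C = B1],
        use that B1 in \<open>auto intro: borel_compact\<close>,
        rule set_integrable_lebesgue_bounded[where a = x0 and R = \<rho> and C = B2],
        use that B2 in \<open>auto intro: borel_compact\<close>)
  moreover have "(\<integral>x. U x * partial_deriv i \<phi> x \<partial>lebesgue_on (ball x0 \<rho>)) =
      - (\<integral>x. (DU x \<bullet> i) * \<phi> x \<partial>lebesgue_on (ball x0 \<rho>))"
    if \<phi>: "\<phi> \<in> test_functions (ball x0 \<rho>)" and i: "i \<in> Basis" for \<phi> i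
  proof -
    note [measurable] = borel_measurable_continuous_onI[OF test_function_continuous(1)[OF \<phi>]]
      borel_measurable_continuous_onI[OF test_function_continuous(2)[OF \<phi>]]
    note z = test_function_eq_0[OF \<phi>]
    obtain B where B: "0 \<le> B" "\<And>x. \<bar>\<phi> x\<bar> \<le> B" "\<And>x. norm (grad \<phi> x) \<le> B"
      using test_function_bounded[OF \<phi>] by blast
    \<comment> \<open>This is the gradient of \<open>U * \<phi>\<close>. That each of its components
      integrates to 0 is the integration by parts required of a weak gradient.\<close>
    define G where "G = (\<lambda>x. U x *\<^sub>R grad \<phi> x + \<phi> x *\<^sub>R DU x)"
    have [measurable]: "G \<in> borel_measurable borel"
      unfolding G_def by measurable
    have G0: "(\<integral>x. G x \<bullet> i \<partial>lborel) = 0"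
    proof (rule integral_gradient_eq_0(2)[where F = "\<lambda>x. U x * \<phi> x" and a = x0 and R = \<rho> and C = "B1 * B + B * B2"])
      show "GDERIV (\<lambda>x. U x * \<phi> x) x :> G x" for x
        unfolding G_def by (rule GDERIV_mult[OF GDERIV_U test_function_GDERIV[OF \<phi>]])
      show "norm (G x) \<le> B1 * B + B * B2" for x
      proof (cases "x \<in> ball x0 \<rho>")
        case True
        then show ?thesis
          unfolding G_def using B1 B2 B
          by (intro norm_triangle_le add_mono) (auto intro!: mult_mono)
      next
        case False
        then show ?thesis
          unfolding G_def using z[OF False] B1 B2 B by simp
      qed
      show "U x * \<phi> x = 0" if "x \<notin> cball x0 \<rho>" for x
        using that z[of x] by simp
    qed simp
    have int1: "integrable lborel (\<lambda>x. U x * partial_deriv i \<phi> x)"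
      and m1: "(\<lambda>x. U x * partial_deriv i \<phi> x) \<in> borel_measurable borel"
      and z1: "\<And>x. x \<notin> ball x0 \<rho> \<Longrightarrow> U x * partial_deriv i \<phi> x = 0"
    proof -
      show m: "(\<lambda>x. U x * partial_deriv i \<phi> x) \<in> borel_measurable borel"
        unfolding grad_inner_Basis[OF i, symmetric] by measurable
      show zz: "U x * partial_deriv i \<phi> x = 0" if "x \<notin> ball x0 \<rho>" for x
        unfolding grad_inner_Basis[OF i, symmetric] using z[OF that] by simp
      have "norm (U x * partial_deriv i \<phi> x) \<le> B1 * B" for x
      proof (cases "x \<in> ball x0 \<rho>")
        case True
        have "\<bar>grad \<phi> x \<bullet> i\<bar> \<le> B"
          using Basis_le_norm[OF i, of "grad \<phi> x"] B(3)[of x] by linarith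
        then show ?thesis
          unfolding grad_inner_Basis[OF i, symmetric] using B1 B True
          by (auto simp: abs_mult intro!: mult_mono)
      next
        case False
        then show ?thesis unfolding zz[OF False] using B1 B by simp
      qed
      then show "integrable lborel (\<lambda>x. U x * partial_deriv i \<phi> x)"
        by (rule integrable_lborel_bounded_support[OF m, where a = x0 and R = \<rho>]) (use zz in auto)
    qed
    have int2: "integrable lborel (\<lambda>x. (DU x \<bullet> i) * \<phi> x)"
      and m2: "(\<lambda>x. (DU x \<bullet> i) * \<phi> x) \<in> borel_measurable borel"
      and z2: "\<And>x. x \<notin> ball x0 \<rho> \<Longrightarrow> (DU x \<bullet> i) * \<phi> x = 0"
    proof -
      show m: "(\<lambda>x. (DU x \<bullet> i) * \<phi> x) \<in> borel_measurable borel"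
        by measurable
      show zz: "(DU x \<bullet> i) * \<phi> x = 0" if "x \<notin> ball x0 \<rho>" for x
        using z[OF that] by simp
      have "norm ((DU x \<bullet> i) * \<phi> x) \<le> B2 * B" for x
      proof (cases "x \<in> ball x0 \<rho>")
        case True
        have "\<bar>DU x \<bullet> i\<bar> \<le> B2"
          using Basis_le_norm[OF i, of "DU x"] B2(2)[OF True] by linarith
        then show ?thesis
          using B2 B by (auto simp: abs_mult intro!: mult_mono)
      next
        case False
        then show ?thesis unfolding zz[OF False] using B2 B by simp
      qed
      then show "integrable lborel (\<lambda>x. (DU x \<bullet> i) * \<phi> x)"
        by (rule integrable_lborel_bounded_support[OF m, where a = x0 and R = \<rho>]) (use zz in auto)
    qed
    have "G x \<bullet> i = U x * partial_deriv i \<phi> x + (DU x \<bullet> i) * \<phi> x" for x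
      by (simp add: G_def inner_add_left grad_inner_Basis[OF i])
    then have "(\<integral>x. U x * partial_deriv i \<phi> x \<partial>lborel) + (\<integral>x. (DU x \<bullet> i) * \<phi> x \<partial>lborel) = 0"
      using G0 int1 int2 by simp
    moreover have "(\<integral>x. U x * partial_deriv i \<phi> x \<partial>lebesgue_on (ball x0 \<rho>)) = (\<integral>x. U x * partial_deriv i \<phi> x \<partial>lborel)"
      by (rule integral_lebesgue_on_eq_lborel[OF m1 _ z1]) auto
    moreover have "(\<integral>x. (DU x \<bullet> i) * \<phi> x \<partial>lebesgue_on (ball x0 \<rho>)) = (\<integral>x. (DU x \<bullet> i) * \<phi> x \<partial>lborel)"
      by (rule integral_lebesgue_on_eq_lborel[OF m2 _ z2]) auto
    ultimately show ?thesis by linarith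
  qed
  ultimately show ?thesis
    unfolding in_W1p_def has_weak_gradient_def by blast
qed

text \<open>The field has length slope^(p-1) = flux / r^(N-1) and direction -(x - x0)/r; normalising
  the direction turns the exponent N - 1 into N. In this form no power depending on p is left, so p
  < 2 needs no separate treatment.\<close>

lemma p_flux_eq:
  "norm (DU x) powr (p - 2) *\<^sub>R DU x = - (flux (norm (x - x0)) / norm (x - x0) ^ N) *\<^sub>R (x - x0)"
proof (cases "x = x0")
  case True
  then show ?thesis by (simp add: DU_def)
next
  case False
  define r where "r = norm (x - x0)"
  have r: "0 < r" using False by (simp add: r_def)
  have "slope r powr (p - 2) * slope r = slope r powr (p - 1)"
    using slope_nonneg[of r] powr_add[of "slope r" "p - 2" 1] by (cases "slope r = 0") auto
  then have "slope r powr (p - 2) * (slope r / r) = flux r / r ^ (N - 1) / r"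
    using slope_powr[of r] r by simp
  also have "\<dots> = flux r / r ^ N"
    using power_Suc[of r "N - 1"] N by (simp add: mult.commute)
  finally show ?thesis
    unfolding norm_DU unfolding DU_def r_def[symmetric] by simp
qed

text \<open>The radial function \<open>c = flux / r\<^sup>N\<close> satisfies \<open>N c + r c' = b\<close>, so that the Euler derivative
  of \<open>c \<phi>\<close> yields the weak formulation.\<close>

lemma weak_formulation:
  assumes \<phi>: "\<phi> \<in> test_functions (ball x0 \<rho>)"
  shows "integrable lborel (\<lambda>x. (norm (DU x) powr (p - 2) *\<^sub>R DU x) \<bullet> grad \<phi> x)"
    and "integrable lborel (\<lambda>x. b (norm (x - x0)) * \<phi> x)"
    and "(\<integral>x. (norm (DU x) powr (p - 2) *\<^sub>R DU x) \<bullet> grad \<phi> x \<partial>lborel) =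
      (\<integral>x. b (norm (x - x0)) * \<phi> x \<partial>lborel)"
proof -
  note [measurable] = borel_measurable_continuous_onI[OF test_function_continuous(1)[OF \<phi>]]
    borel_measurable_continuous_onI[OF test_function_continuous(2)[OF \<phi>]]
    measurable_radial[OF flux_cont] measurable_radial[OF b_cont]
  note z = test_function_eq_0[OF \<phi>]
  obtain B where B: "0 \<le> B" "\<And>x. \<bar>\<phi> x\<bar> \<le> B" "\<And>x. norm (grad \<phi> x) \<le> B"
    using test_function_bounded[OF \<phi>] by blast
  have "bounded (b ` {0..\<rho>})"
    by (intro compact_imp_bounded compact_continuous_image continuous_on_subset[OF b_cont]) auto
  then obtain C where "\<forall>r\<in>{0..\<rho>}. \<bar>b r\<bar> \<le> C"
    unfolding bounded_iff by auto
  then have C: "b r \<le> C" if "0 \<le> r" "r \<le> \<rho>" for r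
    using that by (meson abs_le_D1 atLeastAtMost_iff)
  have C0: "0 \<le> C" using C[of 0] b_nonneg[of 0] \<rho> by linarith
  define c where "c = (\<lambda>r. flux r / r ^ N)"
  have c_bd: "0 \<le> c r" "c r \<le> C" if "0 \<le> r" "r \<le> \<rho>" for r
  proof -
    show "0 \<le> c r" using that flux_nonneg[of r] by (simp add: c_def)
    have "flux r \<le> C * r ^ N" by (rule flux_le) (use that C in auto)
    then show "c r \<le> C"
      using that N C0 by (cases "r = 0") (auto simp: c_def divide_le_eq power_0_left)
  qed
  have c_der: "(c has_real_derivative (b r - real N * c r) / r) (at r)" if r: "0 < r" for r
  proof -
    have "(flux has_real_derivative r ^ (N - 1) * b r) (at r)"
      unfolding flux_def[abs_def] by (rule DERIV_integral_from_0(1)[OF density_cont r])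
    then have "(c has_real_derivative
        (r ^ (N - 1) * b r * r ^ N - flux r * (real N * r ^ (N - 1))) / (r ^ N * r ^ N)) (at r)"
      unfolding c_def using r N by (auto intro!: derivative_eq_intros)
    moreover have "r ^ N = r * r ^ (N - 1)"
      using power_Suc[of r "N - 1"] N by simp
    then have "(r ^ (N - 1) * b r * r ^ N - flux r * (real N * r ^ (N - 1))) / (r ^ N * r ^ N) =
        (b r - real N * c r) / r"
      using r by (simp add: c_def divide_simps) (simp add: algebra_simps)
    ultimately show ?thesis
      by metis
  qed
  define cx where "cx = (\<lambda>x. c (norm (x - x0)))"
  have [measurable]: "cx \<in> borel_measurable borel"
    unfolding cx_def c_def by measurable
  define bx where "bx = (\<lambda>x. b (norm (x - x0)))"
  have [measurable]: "bx \<in> borel_measurable borel"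
    unfolding bx_def by measurable
  have in_ball: "norm (x - x0) \<le> \<rho>" if "x \<in> ball x0 \<rho>" for x
    using that by (simp add: dist_norm norm_minus_commute)
  have cx_bd: "\<bar>cx x\<bar> \<le> C" if "x \<in> ball x0 \<rho>" for x
    using c_bd[of "norm (x - x0)"] in_ball[OF that] by (simp add: cx_def)
  have bx_bd: "\<bar>bx x\<bar> \<le> C" if "x \<in> ball x0 \<rho>" for x
    using C[of "norm (x - x0)"] b_nonneg[of "norm (x - x0)"] in_ball[OF that] by (simp add: bx_def)
  \<comment> \<open>Product rule for \<open>cx * \<phi>\<close> with c' = (b - N c)/r; the second
    division by the norm normalises the radial direction.\<close>
  define G where "G = (\<lambda>x. cx x *\<^sub>R grad \<phi> x +
      \<phi> x *\<^sub>R (((bx x - real N * cx x) / norm (x - x0) / norm (x - x0)) *\<^sub>R (x - x0)))"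
  define W where "W = (\<lambda>x. cx x * (grad \<phi> x \<bullet> (x - x0)))"
  \<comment> \<open>Pairing with x - x0 cancels the division by r. The Euler derivative is thus
    bounded, although \<open>G\<close> itself may blow up at the centre for a source that is merely
    continuous.\<close>
  have GW: "G x \<bullet> (x - x0) = W x + bx x * \<phi> x - real N * (cx x * \<phi> x)" if "x \<noteq> x0" for x
  proof -
    have "(bx x - real N * cx x) / norm (x - x0) / norm (x - x0) * ((x - x0) \<bullet> (x - x0)) = bx x - real N * cx x"
      using that by (simp add: dot_square_norm power2_eq_square)
    then have "G x \<bullet> (x - x0) = W x + \<phi> x * (bx x - real N * cx x)"
      unfolding G_def W_def by (simp only: inner_add_left inner_scaleR_left)
    then show ?thesis
      by (simp add: algebra_simps)
  qed
  have W_bd: "\<bar>W x\<bar> \<le> C * (B * \<rho>)" for x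
  proof (cases "x \<in> ball x0 \<rho>")
    case True
    have "\<bar>grad \<phi> x \<bullet> (x - x0)\<bar> \<le> norm (grad \<phi> x) * norm (x - x0)"
      by (rule Cauchy_Schwarz_ineq2)
    also have "\<dots> \<le> B * \<rho>"
      using B in_ball[OF True] by (intro mult_mono) auto
    finally show ?thesis
      unfolding W_def abs_mult using cx_bd[OF True] C0 by (intro mult_mono) auto
  next
    case False
    then show ?thesis using z[OF False] B C0 \<rho> by (simp add: W_def)
  qed
  have b\<phi>_bd: "\<bar>bx x * \<phi> x\<bar> \<le> C * B" for x
  proof (cases "x \<in> ball x0 \<rho>")
    case True
    then show ?thesis
      unfolding abs_mult using bx_bd[OF True] C0 B by (intro mult_mono) auto
  next
    case False
    then show ?thesis using z[OF False] B C0 by simp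
  qed
  have c\<phi>_bd: "\<bar>cx x * \<phi> x\<bar> \<le> C * B" for x
  proof (cases "x \<in> ball x0 \<rho>")
    case True
    then show ?thesis
      unfolding abs_mult using cx_bd[OF True] C0 B by (intro mult_mono) auto
  next
    case False
    then show ?thesis using z[OF False] B C0 by simp
  qed
  have supp: "cx x * \<phi> x = 0" "bx x * \<phi> x = 0" "W x = 0" if "x \<notin> cball x0 \<rho>" for x
    using that z[of x] by (auto simp: W_def)
  have G_bd: "\<bar>G x \<bullet> (x - x0)\<bar> \<le> C * (B * \<rho>) + C * B + real N * (C * B)" for x
  proof (cases "x = x0")
    case True
    then show ?thesis using B C0 \<rho> by simp
  next
    case False
    have "real N * \<bar>cx x * \<phi> x\<bar> \<le> real N * (C * B)"
      using c\<phi>_bd by (intro mult_left_mono) auto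
    then show ?thesis
      unfolding GW[OF False] using W_bd[of x] b\<phi>_bd[of x]
        abs_triangle_ineq4[of "W x + bx x * \<phi> x" "real N * (cx x * \<phi> x)"]
        abs_triangle_ineq[of "W x" "bx x * \<phi> x"] abs_mult[of "real N" "cx x * \<phi> x"]
      by linarith
  qed
  have G_der: "GDERIV (\<lambda>x. cx x * \<phi> x) x :> G x" if "x \<noteq> x0" for x
    unfolding G_def cx_def bx_def
    by (rule GDERIV_mult[OF GDERIV_radial[OF that c_der] test_function_GDERIV[OF \<phi>]]) (use that in simp)
  have Gm: "G \<in> borel_measurable borel" and Wm: "W \<in> borel_measurable borel"
    unfolding G_def W_def by measurable
  have cm: "(\<lambda>x. cx x * \<phi> x) \<in> borel_measurable borel"
    by measurable
  note E = integral_euler_derivative[OF cm Gm G_der c\<phi>_bd G_bd supp(1)]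
  have iW: "integrable lborel W"
    by (rule integrable_lborel_bounded_support[OF Wm _ supp(3)]) (use W_bd in auto)
  have ib: "integrable lborel (\<lambda>x. bx x * \<phi> x)"
    by (rule integrable_lborel_bounded_support[OF _ _ supp(2)]) (use b\<phi>_bd in auto)
  have "(\<integral>x. G x \<bullet> (x - x0) \<partial>lborel) = (\<integral>x. W x + bx x * \<phi> x - real N * (cx x * \<phi> x) \<partial>lborel)"
  proof (rule integral_cong_AE)
    show "AE x in lborel. G x \<bullet> (x - x0) = W x + bx x * \<phi> x - real N * (cx x * \<phi> x)"
      using AE_lborel_singleton[of x0] by eventually_elim (rule GW)
  qed (use Gm Wm in measurable)
  also have "\<dots> = (\<integral>x. W x \<partial>lborel) + (\<integral>x. bx x * \<phi> x \<partial>lborel) - real N * (\<integral>x. cx x * \<phi> x \<partial>lborel)"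
    using iW ib E(1) by simp
  \<comment> \<open>The Euler identity contributes the dimension times the integral of
    \<open>cx * \<phi>\<close>, which cancels against the factor N; here N has to be the
    dimension.\<close>
  finally have "(\<integral>x. W x \<partial>lborel) + (\<integral>x. bx x * \<phi> x \<partial>lborel) = 0"
    using E(3) dim by simp
  moreover have W: "(\<lambda>x. (norm (DU x) powr (p - 2) *\<^sub>R DU x) \<bullet> grad \<phi> x) = (\<lambda>x. - W x)"
    unfolding p_flux_eq W_def cx_def c_def by (simp add: inner_commute)
  ultimately show "(\<integral>x. (norm (DU x) powr (p - 2) *\<^sub>R DU x) \<bullet> grad \<phi> x \<partial>lborel) =
      (\<integral>x. b (norm (x - x0)) * \<phi> x \<partial>lborel)"
    by (simp add: bx_def)
  show "integrable lborel (\<lambda>x. (norm (DU x) powr (p - 2) *\<^sub>R DU x) \<bullet> grad \<phi> x)"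
    unfolding W using iW by simp
  show "integrable lborel (\<lambda>x. b (norm (x - x0)) * \<phi> x)"
    using ib by (simp add: bx_def)
qed

theorem p_Laplace_weak_solution_U:
  assumes F: "\<And>x. x \<in> ball x0 \<rho> \<Longrightarrow> F x (U x) (norm (DU x)) = b (norm (x - x0))"
  shows "p_Laplace_weak_solution p (ball x0 \<rho>) F U DU"
proof -
  obtain B where B: "0 \<le> B" "\<And>x. x \<in> ball x0 \<rho> \<Longrightarrow> \<bar>U x\<bar> \<le> B"
    using radial_bounded[OF u_cont] unfolding U_def by blast
  have "Linf_norm (ball x0 \<rho>) U \<le> ereal B"
    by (rule Linf_norm_le[OF measurable_U]) (use B in auto)
  then have "in_Linf (ball x0 \<rho>) U"
    unfolding in_Linf_def using measurable_lebesgue_on_borel[OF measurable_U]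
    by (auto intro: order_le_less_trans[of _ "ereal B"])
  moreover have "continuous_on (closure (ball x0 \<rho>)) U"
    by (rule continuous_on_subset[OF U_cont]) simp
  moreover have "U x = 0" if "x \<in> frontier (ball x0 \<rho>)" for x
  proof -
    have "norm (x - x0) = \<rho>"
      using that \<rho> by (simp add: frontier_ball dist_norm norm_minus_commute)
    then show ?thesis using u[of \<rho>] \<rho> by (simp add: U_def)
  qed
  moreover have "integrable (lebesgue_on (ball x0 \<rho>)) (\<lambda>x. (norm (DU x) powr (p - 2) *\<^sub>R DU x) \<bullet> grad \<phi> x) \<and>
        integrable (lebesgue_on (ball x0 \<rho>)) (\<lambda>x. F x (U x) (norm (DU x)) * \<phi> x) \<and>
        (\<integral>x. (norm (DU x) powr (p - 2) *\<^sub>R DU x) \<bullet> grad \<phi> x \<partial>lebesgue_on (ball x0 \<rho>)) =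
        (\<integral>x. F x (U x) (norm (DU x)) * \<phi> x \<partial>lebesgue_on (ball x0 \<rho>))"
    if \<phi>: "\<phi> \<in> test_functions (ball x0 \<rho>)" for \<phi>
  proof -
    note z = test_function_eq_0[OF \<phi>]
    have int: "integrable (lebesgue_on (ball x0 \<rho>)) g" if "integrable lborel g" for g :: "'a \<Rightarrow> real"
    proof -
      have "integrable lebesgue g"
        using that by (subst integrable_completion) auto
      then have "set_integrable lebesgue (ball x0 \<rho>) g"
        unfolding set_integrable_def by (intro integrable_mult_indicator) auto
      then show ?thesis
        by (subst integrable_lebesgue_on_iff) auto
    qed
    have m1: "(\<lambda>x. (norm (DU x) powr (p - 2) *\<^sub>R DU x) \<bullet> grad \<phi> x) \<in> borel_measurable borel"
      and m2: "(\<lambda>x. b (norm (x - x0)) * \<phi> x) \<in> borel_measurable borel"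
      using borel_measurable_integrable[OF weak_formulation(1)[OF \<phi>]]
        borel_measurable_integrable[OF weak_formulation(2)[OF \<phi>]] by (simp_all only: measurable_lborel1 measurable_lborel2)
    have Fb: "F x (U x) (norm (DU x)) * \<phi> x = b (norm (x - x0)) * \<phi> x" if "x \<in> space (lebesgue_on (ball x0 \<rho>))" for x
      using F[of x] that by (simp add: space_restrict_space)
    have "(\<integral>x. (norm (DU x) powr (p - 2) *\<^sub>R DU x) \<bullet> grad \<phi> x \<partial>lebesgue_on (ball x0 \<rho>)) =
        (\<integral>x. (norm (DU x) powr (p - 2) *\<^sub>R DU x) \<bullet> grad \<phi> x \<partial>lborel)"
      by (rule integral_lebesgue_on_eq_lborel[OF m1]) (auto simp: z(2))
    also have "\<dots> = (\<integral>x. b (norm (x - x0)) * \<phi> x \<partial>lborel)"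
      by (rule weak_formulation(3)[OF \<phi>])
    also have "\<dots> = (\<integral>x. b (norm (x - x0)) * \<phi> x \<partial>lebesgue_on (ball x0 \<rho>))"
      by (rule integral_lebesgue_on_eq_lborel[OF m2, symmetric]) (auto intro: z(1))
    also have "\<dots> = (\<integral>x. F x (U x) (norm (DU x)) * \<phi> x \<partial>lebesgue_on (ball x0 \<rho>))"
      by (rule Bochner_Integration.integral_cong[OF refl]) (simp add: Fb)
    finally show ?thesis
      using int[OF weak_formulation(1)[OF \<phi>]]
        Bochner_Integration.integrable_cong[OF refl Fb, THEN iffD2, OF _ int[OF weak_formulation(2)[OF \<phi>]]] by blast
  qed
  ultimately show ?thesis
    unfolding p_Laplace_weak_solution_def using in_W1p_U by blast
qed

end

section \<open>The radial fixed point problem\<close>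

lemma phi_q_nonneg: "0 \<le> phi_q p x"
  by (simp add: phi_q_def)

lemma phi_q_mult: "0 \<le> x \<Longrightarrow> 0 \<le> y \<Longrightarrow> phi_q p (x * y) = phi_q p x * phi_q p y"
  by (simp add: phi_q_def powr_mult)

lemma phi_q_powr: "1 < p \<Longrightarrow> 0 \<le> x \<Longrightarrow> phi_q p (x powr (p - 1)) = x"
  by (simp add: phi_q_def powr_powr)

text \<open>\<open>k1\<close> and \<open>k2\<close> are heights of profiles raised to the power 1 -
  p; under \<open>phi_q\<close> they become the reciprocals that normalise these profiles.\<close>

lemma phi_q_powr_minus:
  assumes "1 < p" "0 < x"
  shows "phi_q p (x powr (1 - p)) = 1 / x"
proof -
  have "(1 - p) * (1 / (p - 1)) = - 1"
    using assms by (simp add: field_simps)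
  then show ?thesis
    unfolding phi_q_def powr_powr using assms by (simp add: powr_minus_divide)
qed

lemma phi_q_mono: "1 < p \<Longrightarrow> 0 \<le> x \<Longrightarrow> x \<le> y \<Longrightarrow> phi_q p x \<le> phi_q p y"
  unfolding phi_q_def by (intro powr_mono2) auto

lemma continuous_on_phi_q:
  assumes "continuous_on S g" "\<And>x. x \<in> S \<Longrightarrow> 0 \<le> g x" "1 < p"
  shows "continuous_on S (\<lambda>x. phi_q p (g x))"
  unfolding phi_q_def by (rule continuous_on_powr') (use assms in \<open>auto intro!: continuous_intros\<close>)

text \<open>For y unrelated to r the quotient has no limit at the centre in general. The cap C r
  squeezes the clamped value to 0 there, uniformly in y.\<close>

lemma continuous_on_clamped_mean_flux:
  fixes C :: real and n :: nat
  assumes C: "0 \<le> C" and n: "0 < n"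
  shows "continuous_on ({0..} \<times> UNIV) (\<lambda>(r, y). max 0 (min (y / r ^ n) (C * r)))"
  unfolding continuous_on_eq_continuous_within
proof safe
  fix r y :: real assume r: "0 \<le> r"
  let ?m = "\<lambda>(r, y). max 0 (min (y / r ^ n) (C * r)) :: real"
  show "continuous (at (r, y) within {0..} \<times> UNIV) ?m"
  proof (cases "r = 0")
    case False
    then have "isCont ?m (r, y)"
      unfolding case_prod_unfold by (intro continuous_intros) auto
    then show ?thesis
      by (rule continuous_at_imp_continuous_at_within)
  next
    case True
    have "(?m \<longlongrightarrow> 0) (at (r, y) within {0..} \<times> UNIV)"
    proof (rule Lim_null_comparison)
      show "\<forall>\<^sub>F z in at (r, y) within {0..} \<times> UNIV. norm (?m z) \<le> C * fst z"
        unfolding eventually_at by (rule exI[of _ 1]) (use C in auto)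
      show "((\<lambda>z. C * fst z) \<longlongrightarrow> 0) (at (r, y) within {0..} \<times> UNIV)"
        using True by (auto intro!: tendsto_eq_intros)
    qed
    then show ?thesis
      using True n by (simp add: continuous_within power_0_left)
  qed
qed

text \<open>In terms of the solution \<open>u\<close> and the flux \<open>y(r) = \<integral>\<^sub>0\<^sup>r s\<^sup>N\<^sup>-\<^sup>1 b(s) ds\<close> the radial problem is a planar
  first-order system. Its right-hand side becomes bounded and continuous up to \<open>r = 0\<close> once
  \<open>y / r\<^sup>N\<^sup>-\<^sup>1\<close> is clamped to \<open>[0, C r]\<close>, and the flux of a solution lies in that range anyway.\<close>

theorem radial_fixed_point_exists:
  fixes Fn :: "real \<Rightarrow> real \<Rightarrow> real \<Rightarrow> real"
  assumes N: "1 < N" and p: "1 < p" and \<rho>: "0 < \<rho>"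
    and cont: "continuous_on ({0..\<rho>} \<times> UNIV \<times> UNIV) (\<lambda>(r, a, w). Fn r a w)"
    and nonneg: "\<And>r a w. r \<in> {0..\<rho>} \<Longrightarrow> 0 \<le> Fn r a w"
    and bnd: "\<And>r a w. r \<in> {0..\<rho>} \<Longrightarrow> Fn r a w \<le> C"
  obtains b u where "radial_source N p b"
    "\<And>r. 0 \<le> r \<Longrightarrow> u r = integral {0..\<rho>} (radial_source.slope N p b) - integral {0..r} (radial_source.slope N p b)"
    "\<And>r. r \<in> {0..\<rho>} \<Longrightarrow> b r = Fn r (u r) (radial_source.slope N p b r)"
proof -
  have C: "0 \<le> C" using nonneg[of 0 0 0] bnd[of 0 0 0] \<rho> by auto
  define m where "m = (\<lambda>r y. max 0 (min (y / r ^ (N - 1)) (C * r)))"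
  define A where "A = (\<lambda>r y. phi_q p (m r y))"
  define G where "G = (\<lambda>r z. (- A r (snd z), r ^ (N - 1) * Fn r (fst z) (A r (snd z))))"
  have m_cont: "continuous_on ({0..\<rho>} \<times> UNIV) (\<lambda>(r, y). m r y)"
    unfolding m_def by (rule continuous_on_subset[OF continuous_on_clamped_mean_flux[OF C]]) (use N in auto)
  have m_nonneg: "0 \<le> m r y" for r y
    by (simp add: m_def)
  have m_le: "m r y \<le> C * \<rho>" if "r \<in> {0..\<rho>}" for r y
  proof -
    have "C * r \<le> C * \<rho>" using that C by (intro mult_left_mono) auto
    moreover have "0 \<le> C * \<rho>" using C \<rho> by simp
    ultimately show ?thesis unfolding m_def by linarith
  qed
  have A_cont: "continuous_on ({0..\<rho>} \<times> UNIV) (\<lambda>(r, y). A r y)"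
    using continuous_on_phi_q[OF m_cont _ p] m_nonneg unfolding A_def by (auto simp: case_prod_unfold)
  have A_nonneg: "0 \<le> A r y" for r y
    by (simp add: A_def phi_q_def)
  have A_le: "A r y \<le> phi_q p (C * \<rho>)" if "r \<in> {0..\<rho>}" for r y
    unfolding A_def by (rule phi_q_mono[OF p m_nonneg m_le[OF that]])
  have A_cont': "continuous_on ({0..\<rho>} \<times> UNIV) (\<lambda>v :: real \<times> real \<times> real. A (fst v) (snd (snd v)))"
  proof -
    have "continuous_on ({0..\<rho>} \<times> UNIV) (\<lambda>v :: real \<times> real \<times> real. (fst v, snd (snd v)))"
      by (intro continuous_intros)
    from continuous_on_compose2[OF A_cont this] show ?thesis
      by (simp add: image_subset_iff mem_Times_iff)
  qed
  have F_cont': "continuous_on ({0..\<rho>} \<times> UNIV)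
      (\<lambda>v :: real \<times> real \<times> real. Fn (fst v) (fst (snd v)) (A (fst v) (snd (snd v))))"
  proof -
    have "continuous_on ({0..\<rho>} \<times> UNIV)
        (\<lambda>v :: real \<times> real \<times> real. (fst v, fst (snd v), A (fst v) (snd (snd v))))"
      by (intro continuous_intros A_cont')
    from continuous_on_compose2[OF cont this] show ?thesis
      by (simp add: image_subset_iff mem_Times_iff)
  qed
  have G_cont: "continuous_on ({0..\<rho>} \<times> UNIV) (\<lambda>(s, z). G s z)"
    unfolding G_def case_prod_unfold by (intro continuous_intros A_cont' F_cont')
  have G_bnd: "norm (G s z) \<le> phi_q p (C * \<rho>) + \<rho> ^ (N - 1) * C" if s: "s \<in> {0..\<rho>}" for s z
  proof -
    have "norm (G s z) \<le> \<bar>A s (snd z)\<bar> + \<bar>s ^ (N - 1) * Fn s (fst z) (A s (snd z))\<bar>"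
      unfolding G_def using norm_Pair_le[of "- A s (snd z)" "s ^ (N - 1) * Fn s (fst z) (A s (snd z))"] by simp
    also have "\<bar>s ^ (N - 1) * Fn s (fst z) (A s (snd z))\<bar> \<le> \<rho> ^ (N - 1) * C"
      using s nonneg[OF s] bnd[OF s] \<rho> by (auto simp: abs_mult power_abs intro!: mult_mono power_mono)
    finally show ?thesis
      using A_le[OF s, of "snd z"] A_nonneg[of s "snd z"] by simp
  qed
  obtain z where z: "continuous_on {0..\<rho>} z" "fst (z \<rho>) = 0" "snd (z 0) = 0"
    "\<And>r. r \<in> {0..\<rho>} \<Longrightarrow> z r = z 0 + integral {0..r} (\<lambda>s. G s (z s))"
    using bounded_planar_ode_bvp_exists[OF less_imp_le[OF \<rho>] G_cont G_bnd] by blast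
  have z': "continuous_on {0..\<rho>} (\<lambda>s. (s, z s))"
    by (intro continuous_intros z(1))
  have Gz: "continuous_on {0..\<rho>} (\<lambda>s. G s (z s))"
    using continuous_on_compose2[OF G_cont z'] by auto
  have Gz_int: "(\<lambda>s. G s (z s)) integrable_on {0..r}" if "r \<in> {0..\<rho>}" for r
    by (rule integrable_continuous_real, rule continuous_on_subset[OF Gz]) (use that in auto)
  have a_eq: "fst (z r) = fst (z 0) - integral {0..r} (\<lambda>s. A s (snd (z s)))" if r: "r \<in> {0..\<rho>}" for r
    using z(4)[OF r] integral_linear[OF Gz_int[OF r] bounded_linear_fst] by (simp add: G_def o_def)
  have y_eq: "snd (z r) = integral {0..r} (\<lambda>s. s ^ (N - 1) * Fn s (fst (z s)) (A s (snd (z s))))"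
    if r: "r \<in> {0..\<rho>}" for r
    using z(3) z(4)[OF r] integral_linear[OF Gz_int[OF r] bounded_linear_snd] by (simp add: G_def o_def)
  \<comment> \<open>Beyond \<rho> the source is frozen at its value on the sphere, since
    \<open>radial_source\<close> wants it on [0,\<infinity>).\<close>
  define cl where "cl = (\<lambda>s. max 0 (min s \<rho>))"
  have cl: "cl s \<in> {0..\<rho>}" for s using \<rho> by (auto simp: cl_def)
  have cl_id: "cl s = s" if "s \<in> {0..\<rho>}" for s using that by (auto simp: cl_def)
  define \<beta> where "\<beta> = (\<lambda>s. Fn s (fst (z s)) (A s (snd (z s))))"
  have \<beta>_cont: "continuous_on {0..\<rho>} \<beta>"
    unfolding \<beta>_def using continuous_on_compose2[OF F_cont' z'] by auto
  define b where "b = (\<lambda>s. \<beta> (cl s))"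
  have b_cont: "continuous_on {0..} b"
    unfolding b_def by (rule continuous_on_compose2[OF \<beta>_cont])
      (use cl in \<open>auto simp: cl_def intro!: continuous_intros\<close>)
  interpret radial_source N p b
  proof
    show "0 \<le> b r" if "0 \<le> r" for r
      unfolding b_def \<beta>_def using nonneg cl by blast
  qed (use N p b_cont in auto)
  have b_eq: "b s = \<beta> s" if "s \<in> {0..\<rho>}" for s
    using cl_id[OF that] by (simp add: b_def)
  have flux_eq: "flux r = snd (z r)" if r: "r \<in> {0..\<rho>}" for r
    unfolding flux_def y_eq[OF r]
    by (rule integral_cong) (use r b_eq in \<open>auto simp: \<beta>_def\<close>)
  have slope_A: "slope r = A r (snd (z r))" if r: "r \<in> {0..\<rho>}" for r
  proof -
    have "flux r \<le> C * r ^ N"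
      by (rule flux_le) (use r bnd in \<open>auto simp: b_eq \<beta>_def\<close>)
    also have "\<dots> = C * r * r ^ (N - 1)"
      using power_Suc[of r "N - 1"] N by simp
    finally have "flux r / r ^ (N - 1) \<le> C * r"
      using r N by (cases "r = 0") (auto simp: divide_le_eq power_0_left)
    moreover have "0 \<le> flux r / r ^ (N - 1)"
      using flux_nonneg[of r] r by simp
    ultimately have "m r (flux r) = flux r / r ^ (N - 1)"
      unfolding m_def by simp
    then show ?thesis
      by (simp add: slope_eq A_def flux_eq[OF r])
  qed
  have int_slope: "integral {0..r} slope = fst (z 0) - fst (z r)" if r: "r \<in> {0..\<rho>}" for r
  proof -
    have "integral {0..r} slope = integral {0..r} (\<lambda>s. A s (snd (z s)))"
      by (rule integral_cong) (use r slope_A in auto)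
    then show ?thesis using a_eq[OF r] by simp
  qed
  define u where "u = (\<lambda>r. integral {0..\<rho>} slope - integral {0..r} slope)"
  \<comment> \<open>The condition at \<rho> identifies \<open>fst (z 0)\<close> with the full
    integral of the slope.\<close>
  have "u r = fst (z r)" if r: "r \<in> {0..\<rho>}" for r
    using int_slope[OF r] int_slope[of \<rho>] z(2) \<rho> by (simp add: u_def)
  then have "b r = Fn r (u r) (slope r)" if r: "r \<in> {0..\<rho>}" for r
    using b_eq[OF r] slope_A[OF r] r by (simp add: \<beta>_def)
  then show thesis
    using that[of b u] radial_source_axioms by (simp add: u_def)
qed

section \<open>Bounds for the radial quantities\<close>

locale radial_weight =
  fixes N :: nat and p \<rho> :: real and \<omega> :: "real \<Rightarrow> real"
  assumes N: "1 < N" and p: "1 < p" and \<rho>: "0 < \<rho>"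
    and \<omega>_cont: "continuous_on {0..\<rho>} \<omega>" and \<omega>_nonneg: "\<And>r. r \<in> {0..\<rho>} \<Longrightarrow> 0 \<le> \<omega> r"
begin

definition I :: "real \<Rightarrow> real" where
  "I r = integral {0..r} (\<lambda>s. K N \<omega> s r)"

lemma K_integrable: "0 \<le> a \<Longrightarrow> c \<le> \<rho> \<Longrightarrow> (\<lambda>s. K N \<omega> s r) integrable_on {a..c}"
  unfolding K_def divide_inverse
  by (intro integrable_continuous_real continuous_intros continuous_on_subset[OF \<omega>_cont]) auto

lemma I_nonneg: "r \<in> {0..\<rho>} \<Longrightarrow> 0 \<le> I r"
  unfolding I_def by (rule integral_nonneg[OF K_integrable]) (auto simp: K_def intro!: mult_nonneg_nonneg \<omega>_nonneg)

lemma I_cont: "continuous_on {0..\<rho>} I"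
proof -
  \<comment> \<open>Extended by constants, the weight is itself a source and \<open>I\<close> is its
    mean flux, so continuity at r = 0 is already known.\<close>
  define w where "w = (\<lambda>s. \<omega> (max 0 (min s \<rho>)))"
  interpret w: radial_source N p w
  proof
    show "continuous_on {0..} w"
      unfolding w_def by (rule continuous_on_compose2[OF \<omega>_cont]) (use \<rho> in \<open>auto intro!: continuous_intros\<close>)
    show "0 \<le> w r" for r
      unfolding w_def using \<rho> by (intro \<omega>_nonneg) auto
  qed (rule N p)+
  have "I r = w.flux r / r ^ (N - 1)" if "r \<in> {0..\<rho>}" for r
    unfolding I_def integral_K_eq w.flux_def
    by (rule arg_cong[where f = "\<lambda>y. y / r ^ (N - 1)"], rule integral_cong) (use that in \<open>auto simp: w_def\<close>)
  moreover have "continuous_on {0..\<rho>} (\<lambda>r. w.flux r / r ^ (N - 1))"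
    by (rule continuous_on_subset[OF w.mean_flux_cont]) auto
  ultimately show ?thesis
    using continuous_on_cong[OF refl, of "{0..\<rho>}" I "\<lambda>r. w.flux r / r ^ (N - 1)"] by blast
qed

lemma phi_q_I_cont: "continuous_on {0..\<rho>} (\<lambda>r. phi_q p (I r))"
  by (rule continuous_on_phi_q[OF I_cont I_nonneg p])

lemma k1_nonneg: "0 \<le> k1 N p \<omega> \<rho>"
  by (simp add: k1_def)

lemma phi_q_k1_I: "r \<in> {0..\<rho>} \<Longrightarrow> phi_q p (k1 N p \<omega> \<rho> * I r) = phi_q p (k1 N p \<omega> \<rho>) * phi_q p (I r)"
  by (rule phi_q_mult[OF k1_nonneg I_nonneg])

lemma phi_q_k1_I_cont: "continuous_on {0..\<rho>} (\<lambda>r. phi_q p (k1 N p \<omega> \<rho> * I r))"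
  by (rule continuous_on_phi_q[OF _ _ p]) (use I_nonneg k1_nonneg in \<open>auto intro!: continuous_intros I_cont\<close>)

lemma gamma_rho_ge:
  assumes "r \<in> {0..\<rho>}"
  shows "phi_q p (k1 N p \<omega> \<rho> * I r) \<le> gamma_rho N p \<omega> \<rho>"
  unfolding gamma_rho_def I_def[symmetric]
  by (rule cSUP_upper[OF assms])
    (intro bounded_imp_bdd_above compact_imp_bounded compact_continuous_image phi_q_k1_I_cont compact_Icc)

lemma gamma_rho_nonneg: "0 \<le> gamma_rho N p \<omega> \<rho>"
  using gamma_rho_ge[of 0] phi_q_nonneg \<rho> by (meson atLeastAtMost_iff less_imp_le order_refl order_trans)

lemma phi_rho_eq: "phi_rho N p \<omega> \<rho> r = integral {r..\<rho>} (\<lambda>\<theta>. phi_q p (I \<theta>))"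
  by (simp add: phi_rho_def I_def)

lemma k1_phi_rho_le:
  assumes r: "r \<in> {0..\<rho>}"
  shows "phi_q p (k1 N p \<omega> \<rho>) * phi_rho N p \<omega> \<rho> r \<le> 1"
proof -
  define S where "S = (SUP r\<in>{0..\<rho>}. \<bar>phi_rho N p \<omega> \<rho> r\<bar>)"
  have "continuous_on {0..\<rho>} (\<lambda>r. \<bar>phi_rho N p \<omega> \<rho> r\<bar>)"
    unfolding phi_rho_eq
    by (intro continuous_intros indefinite_integral_continuous_1' integrable_continuous_real phi_q_I_cont)
  then have "bdd_above ((\<lambda>r. \<bar>phi_rho N p \<omega> \<rho> r\<bar>) ` {0..\<rho>})"
    by (intro bounded_imp_bdd_above compact_imp_bounded compact_continuous_image compact_Icc)
  then have le: "\<bar>phi_rho N p \<omega> \<rho> r\<bar> \<le> S"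
    unfolding S_def using r by (intro cSUP_upper)
  have k1: "k1 N p \<omega> \<rho> = S powr (1 - p)"
    by (simp add: k1_def S_def)
  show ?thesis
  \<comment> \<open>S is the height of \<open>phi_rho\<close>, and \<open>phi_q\<close> maps
    \<open>k1\<close> to 1/S. If S = 0, then \<open>phi_rho\<close> vanishes and the bound is
    trivial.\<close>
  proof (cases "S = 0")
    case True
    then show ?thesis using le by simp
  next
    case False
    with le have S: "0 < S" by linarith
    have "1 / S * phi_rho N p \<omega> \<rho> r \<le> 1"
      using le S by (simp add: divide_le_eq)
    then show ?thesis
      unfolding k1 phi_q_powr_minus[OF p S] .
  qed
qed

lemma Phi_eq: "Phi N p \<omega> \<rho> M r = M * integral {r..\<rho>} (\<lambda>\<theta>. phi_q p (k1 N p \<omega> \<rho> * I \<theta>))"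
  by (simp add: Phi_def I_def)

lemma Phi_le:
  assumes r: "r \<in> {0..\<rho>}" and M: "0 \<le> M"
  shows "Phi N p \<omega> \<rho> M r \<le> M"
proof -
  have "integral {r..\<rho>} (\<lambda>\<theta>. phi_q p (k1 N p \<omega> \<rho> * I \<theta>)) =
      integral {r..\<rho>} (\<lambda>\<theta>. phi_q p (k1 N p \<omega> \<rho>) * phi_q p (I \<theta>))"
    by (rule integral_cong) (use r phi_q_k1_I in auto)
  also have "\<dots> = phi_q p (k1 N p \<omega> \<rho>) * phi_rho N p \<omega> \<rho> r"
    by (simp add: phi_rho_eq)
  also have "\<dots> \<le> 1"
    by (rule k1_phi_rho_le[OF r])
  finally show ?thesis
    unfolding Phi_eq using M by (simp add: mult_left_le)
qed

end

section \<open>The lower comparison profile\<close>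

lemma integral_pos_continuous:
  fixes g :: "real \<Rightarrow> real"
  assumes "a < c" "continuous_on {a..c} g" "\<And>x. x \<in> {a..c} \<Longrightarrow> 0 \<le> g x" "x \<in> {a..c}" "0 < g x"
  shows "0 < integral {a..c} g"
proof -
  have "0 \<le> integral {a..c} g"
    by (rule integral_nonneg[OF integrable_continuous_real]) (use assms in auto)
  moreover have "integral {a..c} g \<noteq> 0"
    using integral_eq_0_iff[OF assms(2,1,3)] assms(4,5) by auto
  ultimately show ?thesis by linarith
qed

locale radial_weight_max = radial_weight +
  fixes t :: real
  assumes zeros: "discrete {r \<in> {0..\<rho>}. \<omega> r = 0}"
    and t: "0 < t" "t < \<rho>"
      "\<And>r. r \<in> {0..\<rho>} \<Longrightarrow> k2_integral N p \<omega> \<rho> r \<le> k2_integral N p \<omega> \<rho> t"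
begin

text \<open>Contribution of the weight inside [0,t] to the mean flux at \<theta>; in \<theta> it is
  a pure power.\<close>

definition It :: "real \<Rightarrow> real" where
  "It \<theta> = integral {0..t} (\<lambda>s. K N \<omega> s \<theta>)"

text \<open>Isolated zeros enter here: were \<omega> zero throughout (0,t), the zero t/2 would not
  be isolated. Positivity of \<open>It\<close>, and with it the normalisation by \<open>k2\<close>,
  rests on this.\<close>

lemma ex_weight_pos: "\<exists>s\<in>{0<..<t}. 0 < \<omega> s"
proof (rule ccontr)
  assume neg: "\<not> ?thesis"
  have z: "s \<in> {r \<in> {0..\<rho>}. \<omega> r = 0}" if "s \<in> {0<..<t}" for s
    using neg that t \<omega>_nonneg[of s] by (auto simp: not_less intro: antisym)
  have "t / 2 \<in> {0<..<t}" using t by auto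
  with z zeros have "t / 2 isolated_in {r \<in> {0..\<rho>}. \<omega> r = 0}"
    by (meson discreteD)
  then obtain e where e: "0 < e" "\<And>y. y \<in> {r \<in> {0..\<rho>}. \<omega> r = 0} \<Longrightarrow> dist (t / 2) y < e \<Longrightarrow> y = t / 2"
    unfolding isolated_in_dist_Ex_iff by blast
  \<comment> \<open>The term e/2 keeps y within e of t/2, and t/4 keeps it below t.\<close>
  define y where "y = t / 2 + min (e / 2) (t / 4)"
  have "y \<in> {0<..<t}" "dist (t / 2) y < e" "y \<noteq> t / 2"
    using t e(1) by (auto simp: y_def dist_real_def min_def)
  with e(2)[OF z] show False by blast
qed

lemma It_eq: "It \<theta> = It 1 / \<theta> ^ (N - 1)"
  unfolding It_def integral_K_eq by simp

lemma It_1_pos: "0 < It 1"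
proof -
  obtain s where s: "s \<in> {0<..<t}" "0 < \<omega> s"
    using ex_weight_pos by blast
  have "0 < integral {0..t} (\<lambda>s. K N \<omega> s 1)"
  proof (rule integral_pos_continuous)
    show "continuous_on {0..t} (\<lambda>s. K N \<omega> s 1)"
      unfolding K_def using t by (intro continuous_intros continuous_on_subset[OF \<omega>_cont]) auto
    show "s \<in> {0..t}" "0 < K N \<omega> s 1" using s by (auto simp: K_def)
    show "0 \<le> K N \<omega> x 1" if "x \<in> {0..t}" for x
      using that t by (auto simp: K_def intro!: mult_nonneg_nonneg \<omega>_nonneg)
  qed (use t in auto)
  then show ?thesis by (simp add: It_def)
qed

lemma It_pos: "0 < \<theta> \<Longrightarrow> 0 < It \<theta>"
  using It_1_pos by (subst It_eq) simp

lemma It_cont: "continuous_on {t..\<rho>} It"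
proof -
  have "continuous_on {t..\<rho>} (\<lambda>\<theta>. It 1 / \<theta> ^ (N - 1))"
    using t by (intro continuous_intros) auto
  then show ?thesis
    unfolding It_eq[symmetric] .
qed

lemma k2_integral_t: "k2_integral N p \<omega> \<rho> t = integral {t..\<rho>} (\<lambda>\<theta>. phi_q p (It \<theta>))"
  by (simp add: k2_integral_def It_def)

lemma k2_integral_t_pos: "0 < k2_integral N p \<omega> \<rho> t"
  unfolding k2_integral_t
proof (rule integral_pos_continuous[where x = t])
  show "continuous_on {t..\<rho>} (\<lambda>\<theta>. phi_q p (It \<theta>))"
    by (rule continuous_on_phi_q[OF It_cont _ p]) (use t It_pos in \<open>auto intro: less_imp_le\<close>)
  show "0 < phi_q p (It t)"
    using It_pos[of t] t by (simp add: phi_q_def)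
qed (use t phi_q_nonneg in auto)

lemma k2_eq: "k2 N p \<omega> \<rho> = k2_integral N p \<omega> \<rho> t powr (1 - p)"
proof -
  have "(SUP r\<in>{0..\<rho>}. k2_integral N p \<omega> \<rho> r) = k2_integral N p \<omega> \<rho> t"
    by (rule cSup_eq_maximum) (use t in auto)
  then show ?thesis by (simp add: k2_def)
qed

lemma k2_pos: "0 < k2 N p \<omega> \<rho>"
  using k2_integral_t_pos by (simp add: k2_eq)

text \<open>Beyond t this is the slope of \<Psi>_\<delta> divided by \<delta>, with the sign
  reversed.\<close>

definition Q :: "real \<Rightarrow> real" where
  "Q \<theta> = phi_q p (k2 N p \<omega> \<rho> * It \<theta>)"

lemma Q_pos: "0 < \<theta> \<Longrightarrow> 0 < Q \<theta>"
  using k2_pos It_pos[of \<theta>] by (simp add: Q_def phi_q_def)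

lemma Q_cont: "continuous_on {t..\<rho>} Q"
  unfolding Q_def[abs_def]
proof (rule continuous_on_phi_q[OF continuous_on_mult_left[OF It_cont] _ p])
  show "0 \<le> k2 N p \<omega> \<rho> * It x" if "x \<in> {t..\<rho>}" for x
    using k2_pos It_pos[of x] t that by simp
qed

lemma Q_integrable: "t \<le> a \<Longrightarrow> Q integrable_on {a..\<rho>}"
  by (rule integrable_continuous_real, rule continuous_on_subset[OF Q_cont]) auto

lemma integral_Q_t: "integral {t..\<rho>} Q = 1"
proof -
  have "integral {t..\<rho>} Q = integral {t..\<rho>} (\<lambda>\<theta>. phi_q p (k2 N p \<omega> \<rho>) * phi_q p (It \<theta>))"
    unfolding Q_def
    by (rule integral_cong, rule phi_q_mult) (use t It_pos k2_pos in \<open>auto intro: less_imp_le\<close>)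
  also have "\<dots> = phi_q p (k2 N p \<omega> \<rho>) * k2_integral N p \<omega> \<rho> t"
    by (simp add: k2_integral_t)
  also have "\<dots> = 1"
    unfolding k2_eq phi_q_powr_minus[OF p k2_integral_t_pos] using k2_integral_t_pos by simp
  finally show ?thesis .
qed

text \<open>Since \<open>Q\<close> has integral 1 over {t..\<rho>}, the two branches meet at t with
  the value \<delta>, and a single formula covers both.\<close>

lemma Psi_eq: "Psi N p \<omega> \<rho> t \<delta> r = \<delta> * integral {max r t..\<rho>} Q"
  unfolding Psi_def It_def[symmetric] Q_def[symmetric] using integral_Q_t by (auto simp: max_def)

lemma Psi_cont: "continuous_on {0..\<rho>} (Psi N p \<omega> \<rho> t \<delta>)"
proof -
  have "continuous_on {0..\<rho>} (\<lambda>r. integral {max r t..\<rho>} Q)"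
    by (rule continuous_on_compose2[OF indefinite_integral_continuous_1'[OF Q_integrable[OF order_refl]]])
      (use t in \<open>auto intro!: continuous_intros\<close>)
  then show ?thesis
    unfolding Psi_eq[abs_def] by (intro continuous_intros)
qed

lemma Psi_pos:
  assumes "0 < \<delta>" "r < \<rho>"
  shows "0 < Psi N p \<omega> \<rho> t \<delta> r"
proof -
  have "0 < integral {max r t..\<rho>} Q"
    by (rule integral_pos_continuous[where x = \<rho>])
      (use assms t Q_pos in \<open>auto intro: continuous_on_subset[OF Q_cont] less_imp_le\<close>)
  then show ?thesis
    unfolding Psi_eq using assms by simp
qed

lemma Psi_le:
  assumes "0 \<le> \<delta>"
  shows "Psi N p \<omega> \<rho> t \<delta> r \<le> \<delta>"
proof -
  have "integral {max r t..\<rho>} Q \<le> integral {t..\<rho>} Q"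
    by (rule integral_subset_le) (use Q_integrable t Q_pos in \<open>auto intro: less_imp_le\<close>)
  then show ?thesis
    unfolding Psi_eq integral_Q_t using assms by (simp add: mult_left_le)
qed

end

section \<open>Existence of a positive radial solution\<close>

theorem theorem9:
  fixes x0 :: "'a::euclidean_space"
    and p \<rho> \<delta> M t :: real
    and \<omega> :: "real \<Rightarrow> real"
    and f :: "real \<Rightarrow> real \<Rightarrow> real"
    and N :: nat
  assumes N: "N = DIM('a)" "N > 1"
    and p: "1 < p"
    and \<rho>: "0 < \<rho>"
    and \<omega>_cont: "continuous_on {0..\<rho>} \<omega>"
    and \<omega>_nonneg: "\<And>r. r \<in> {0..\<rho>} \<Longrightarrow> 0 \<le> \<omega> r"
    and \<omega>_zeros: "discrete {r \<in> {0..\<rho>}. \<omega> r = 0}"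
    and f_cont: "continuous_on ({0..} \<times> {0..}) (\<lambda>(a, b). f a b)"
    and f_nonneg: "\<And>a b. 0 \<le> a \<Longrightarrow> 0 \<le> b \<Longrightarrow> 0 \<le> f a b"
    and t: "0 < t" "t < \<rho>"
      "\<And>r. r \<in> {0..\<rho>} \<Longrightarrow> k2_integral N p \<omega> \<rho> r \<le> k2_integral N p \<omega> \<rho> t"
    and \<delta>M: "0 < \<delta>" "\<delta> < M"
    and H1: "\<And>a (v::'a). 0 \<le> a \<Longrightarrow> a \<le> M \<Longrightarrow> norm v \<le> gamma_rho N p \<omega> \<rho> * M \<Longrightarrow>
      0 \<le> f a (norm v) \<and> f a (norm v) \<le> k1 N p \<omega> \<rho> * M powr (p - 1)"
    and H2: "\<And>a (v::'a). \<delta> \<le> a \<Longrightarrow> a \<le> M \<Longrightarrow> norm v \<le> gamma_rho N p \<omega> \<rho> * M \<Longrightarrow>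
      f a (norm v) \<ge> k2 N p \<omega> \<rho> * \<delta> powr (p - 1)"
  shows "\<exists>(u :: real \<Rightarrow> real) (Du :: 'a \<Rightarrow> 'a).
    p_Laplace_weak_solution p (ball x0 \<rho>) (\<lambda>x a b. \<omega> (norm (x - x0)) * f a b)
      (\<lambda>x. u (norm (x - x0))) Du \<and>
    (\<forall>x\<in>ball x0 \<rho>. 0 < u (norm (x - x0))) \<and>
    (\<forall>r\<in>{0..\<rho>}. Psi N p \<omega> \<rho> t \<delta> r \<le> u r \<and> u r \<le> Phi N p \<omega> \<rho> M r) \<and>
    (\<forall>x\<in>ball x0 \<rho>. GDERIV (\<lambda>y. u (norm (y - x0))) x :> Du x \<and>
      norm (Du x) \<le> Gamma_bound N p \<omega> \<rho> M (norm (x - x0))) \<and>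
    ereal \<delta> \<le> Linf_norm (ball x0 \<rho>) (\<lambda>x. u (norm (x - x0))) \<and>
    Linf_norm (ball x0 \<rho>) (\<lambda>x. u (norm (x - x0))) \<le> ereal M \<and>
    Linf_norm (ball x0 \<rho>) Du \<le> ereal (gamma_rho N p \<omega> \<rho> * M)"
proof -
  have dim: "N = DIM('a)" and N1: "1 < N" using N by simp_all
  interpret radial_weight_max N p \<rho> \<omega> t
    by unfold_locales (use N1 p \<rho> \<omega>_cont \<omega>_nonneg \<omega>_zeros t in auto)
  define k\<^sub>1 where "k\<^sub>1 = k1 N p \<omega> \<rho>"
  define k\<^sub>2 where "k\<^sub>2 = k2 N p \<omega> \<rho>"
  define m where "m = gamma_rho N p \<omega> \<rho> * M"
  define \<psi> where "\<psi> = Psi N p \<omega> \<rho> t \<delta>"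
  have M: "0 < M" using \<delta>M by simp
  have m: "0 \<le> m" unfolding m_def using gamma_rho_nonneg M by simp
  have \<psi>_le: "\<psi> r \<le> \<delta>" for r
    unfolding \<psi>_def using Psi_le \<delta>M by simp
  have \<psi>_t: "\<psi> r = \<delta>" if "r \<le> t" for r
    using that by (simp add: \<psi>_def Psi_def)
  have \<psi>_pos: "0 < \<psi> r" if "r < \<rho>" for r
    unfolding \<psi>_def using Psi_pos[OF \<delta>M(1) that] .
  have \<psi>_nonneg: "0 \<le> \<psi> r" if "r \<in> {0..\<rho>}" for r
    using \<psi>_pos[of r] that by (cases "r = \<rho>") (use t in \<open>auto simp: \<psi>_def Psi_eq max_def\<close>)
  \<comment> \<open>Every w >= 0 is the norm of some vector, so the hypotheses phrased with
    \<open>norm v\<close> cover all w in [0,m].\<close>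
  have f_bd: "0 \<le> f a w" "f a w \<le> k\<^sub>1 * M powr (p - 1)" if aw: "0 \<le> a" "a \<le> M" "0 \<le> w" "w \<le> m" for a w
  proof -
    obtain v :: 'a where "norm v = w" using vector_choose_size[OF aw(3)] by blast
    then show "0 \<le> f a w" "f a w \<le> k\<^sub>1 * M powr (p - 1)"
      using H1[of a v] aw by (auto simp: k\<^sub>1_def m_def)
  qed
  have f_ge: "k\<^sub>2 * \<delta> powr (p - 1) \<le> f a w" if aw: "\<delta> \<le> a" "a \<le> M" "0 \<le> w" "w \<le> m" for a w
  proof -
    obtain v :: 'a where "norm v = w" using vector_choose_size[OF aw(3)] by blast
    then show ?thesis
      using H2[of a v] aw by (auto simp: k\<^sub>2_def m_def)
  qed

  \<comment> \<open>The outer \<open>max\<close> makes the lower bound unconditional; the upper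
    bound survives because \<psi> <= \<delta> < M.\<close>
  define \<alpha> where "\<alpha> = (\<lambda>r a. max (\<psi> r) (min a M))"
  define \<beta> where "\<beta> = (\<lambda>w. max 0 (min w m))"
  define Fn where "Fn = (\<lambda>r a w. \<omega> r * f (\<alpha> r a) (\<beta> w))"
  have \<alpha>: "0 \<le> \<alpha> r a" "\<alpha> r a \<le> M" if "r \<in> {0..\<rho>}" for r a
    using \<psi>_nonneg[OF that] \<psi>_le[of r] \<delta>M by (auto simp: \<alpha>_def)
  have \<beta>: "0 \<le> \<beta> w" "\<beta> w \<le> m" for w
    using m by (auto simp: \<beta>_def)
  have Fn_cont: "continuous_on ({0..\<rho>} \<times> UNIV \<times> UNIV) (\<lambda>(r, a, w). Fn r a w)"
  proof -
    have 1: "continuous_on ({0..\<rho>} \<times> UNIV \<times> UNIV) (\<lambda>v :: real \<times> real \<times> real. \<psi> (fst v))"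
      "continuous_on ({0..\<rho>} \<times> UNIV \<times> UNIV) (\<lambda>v :: real \<times> real \<times> real. \<omega> (fst v))"
      unfolding \<psi>_def
      by (rule continuous_on_compose2[OF Psi_cont], auto intro!: continuous_intros)
        (rule continuous_on_compose2[OF \<omega>_cont], auto intro!: continuous_intros)
    have "continuous_on ({0..\<rho>} \<times> UNIV \<times> UNIV)
        (\<lambda>v :: real \<times> real \<times> real. (\<alpha> (fst v) (fst (snd v)), \<beta> (snd (snd v))))"
      unfolding \<alpha>_def \<beta>_def by (intro continuous_intros 1)
    from continuous_on_compose2[OF f_cont this]
    have "continuous_on ({0..\<rho>} \<times> UNIV \<times> UNIV)
        (\<lambda>v :: real \<times> real \<times> real. f (\<alpha> (fst v) (fst (snd v))) (\<beta> (snd (snd v))))"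
      using \<alpha> \<beta> by (simp add: image_subset_iff mem_Times_iff)
    with 1(2) show ?thesis
      unfolding Fn_def case_prod_unfold by (intro continuous_intros)
  qed
  have "bounded (\<omega> ` {0..\<rho>})"
    by (intro compact_imp_bounded compact_continuous_image \<omega>_cont compact_Icc)
  then obtain W where "\<forall>r\<in>{0..\<rho>}. \<bar>\<omega> r\<bar> \<le> W"
    unfolding bounded_iff by auto
  then have W: "\<omega> r \<le> W" if "r \<in> {0..\<rho>}" for r
    using that by (meson abs_le_D1)
  have Fn_nonneg: "0 \<le> Fn r a w" if "r \<in> {0..\<rho>}" for r a w
    unfolding Fn_def using \<omega>_nonneg[OF that] f_bd(1)[OF \<alpha>[OF that] \<beta>] by simp
  have Fn_le: "Fn r a w \<le> \<omega> r * (k\<^sub>1 * M powr (p - 1))" if "r \<in> {0..\<rho>}" for r a w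
    unfolding Fn_def using \<omega>_nonneg[OF that] f_bd(2)[OF \<alpha>[OF that] \<beta>] by (intro mult_left_mono) auto
  have Fn_le': "Fn r a w \<le> W * (k\<^sub>1 * M powr (p - 1))" if "r \<in> {0..\<rho>}" for r a w
    by (rule order_trans[OF Fn_le[OF that]], rule mult_right_mono[OF W[OF that]])
      (use k1_nonneg in \<open>auto simp: k\<^sub>1_def\<close>)
  have Fn_ge: "\<omega> r * (k\<^sub>2 * \<delta> powr (p - 1)) \<le> Fn r a w" if "r \<in> {0..t}" for r a w
  proof -
    have r: "r \<in> {0..\<rho>}" using that t by auto
    have "\<delta> \<le> \<alpha> r a" using \<psi>_t[of r] that by (simp add: \<alpha>_def)
    then show ?thesis
      unfolding Fn_def using \<omega>_nonneg[OF r] f_ge[OF _ \<alpha>(2)[OF r] \<beta>] by (intro mult_left_mono) auto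
  qed

  obtain b u where b: "radial_source N p b" and
    u: "\<And>r. 0 \<le> r \<Longrightarrow> u r = integral {0..\<rho>} (radial_source.slope N p b) - integral {0..r} (radial_source.slope N p b)" and
    bF: "\<And>r. r \<in> {0..\<rho>} \<Longrightarrow> b r = Fn r (u r) (radial_source.slope N p b r)"
    using radial_fixed_point_exists[OF N1 p \<rho> Fn_cont Fn_nonneg Fn_le'] by metis
  interpret b: radial_source N p b by (rule b)
  interpret b: radial_solution N p b x0 \<rho> u
    by unfold_locales (use dim \<rho> u in auto)

  have slope_int: "b.slope integrable_on {r..c}" if "0 \<le> r" for r c
    by (rule integrable_continuous_real, rule continuous_on_subset[OF b.slope_cont]) (use that in auto)
  have Kb_int: "(\<lambda>s. K N b s \<theta>) integrable_on {a..c}" if "0 \<le> a" for a c \<theta>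
    unfolding K_def divide_inverse
    by (intro integrable_continuous_real continuous_intros continuous_on_subset[OF b.b_cont]) (use that in auto)
  have u_eq: "u r = integral {r..\<rho>} b.slope" if "r \<in> {0..\<rho>}" for r
    using Henstock_Kurzweil_Integration.integral_combine[of 0 r \<rho> b.slope] slope_int[of 0 \<rho>] that u[of r] by simp
  \<comment> \<open>The bound on \<open>Fn\<close> holds for all arguments, so nothing about u or
    its slope is presupposed and the estimate is not circular. \<open>phi_q\<close> turns the factor
    M^(p-1) into M.\<close>
  have slope_le: "b.slope r \<le> Gamma_bound N p \<omega> \<rho> M r" if r: "r \<in> {0..\<rho>}" for r
  proof -
    have "integral {0..r} (\<lambda>s. K N b s r) \<le> integral {0..r} (\<lambda>s. (k\<^sub>1 * M powr (p - 1)) * K N \<omega> s r)"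
    proof (rule integral_le)
      show "K N b s r \<le> (k\<^sub>1 * M powr (p - 1)) * K N \<omega> s r" if "s \<in> {0..r}" for s
      proof -
        have "b s \<le> \<omega> s * (k\<^sub>1 * M powr (p - 1))"
          using bF[of s] Fn_le[of s] that r by auto
        then have "(s / r) ^ (N - 1) * b s \<le> (s / r) ^ (N - 1) * (\<omega> s * (k\<^sub>1 * M powr (p - 1)))"
          using that by (intro mult_left_mono) auto
        then show ?thesis by (simp add: K_def mult_ac)
      qed
    qed (use r Kb_int K_integrable in \<open>auto intro!: integrable_on_mult_right\<close>)
    also have "\<dots> = M powr (p - 1) * (k\<^sub>1 * I r)"
      by (simp add: I_def)
    finally have "b.slope r \<le> phi_q p (M powr (p - 1) * (k\<^sub>1 * I r))"
      unfolding b.slope_def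
      by (intro phi_q_mono[OF p] integral_nonneg Kb_int)
        (use r b.b_nonneg in \<open>auto simp: K_def intro!: mult_nonneg_nonneg\<close>)
    also have "\<dots> = M * phi_q p (k\<^sub>1 * I r)"
      using k1_nonneg I_nonneg[OF r] M p by (simp add: phi_q_mult phi_q_powr k\<^sub>1_def)
    finally show ?thesis
      by (simp add: Gamma_bound_def k\<^sub>1_def I_def)
  qed
  have Gamma_le: "Gamma_bound N p \<omega> \<rho> M r \<le> m" if "r \<in> {0..\<rho>}" for r
    using gamma_rho_ge[OF that] M by (simp add: Gamma_bound_def m_def I_def mult.commute)
  have slope_ge: "\<delta> * Q \<theta> \<le> b.slope \<theta>" if \<theta>: "\<theta> \<in> {t..\<rho>}" for \<theta>
  proof -
    have "\<delta> powr (p - 1) * (k\<^sub>2 * It \<theta>) = integral {0..t} (\<lambda>s. (k\<^sub>2 * \<delta> powr (p - 1)) * K N \<omega> s \<theta>)"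
      by (simp add: It_def)
    also have "\<dots> \<le> integral {0..t} (\<lambda>s. K N b s \<theta>)"
    proof (rule integral_le)
      show "(k\<^sub>2 * \<delta> powr (p - 1)) * K N \<omega> s \<theta> \<le> K N b s \<theta>" if "s \<in> {0..t}" for s
      proof -
        have "\<omega> s * (k\<^sub>2 * \<delta> powr (p - 1)) \<le> b s"
          using bF[of s] Fn_ge[of s] that t by auto
        then have "(s / \<theta>) ^ (N - 1) * (\<omega> s * (k\<^sub>2 * \<delta> powr (p - 1))) \<le> (s / \<theta>) ^ (N - 1) * b s"
          using that \<theta> t by (intro mult_left_mono) auto
        then show ?thesis by (simp add: K_def mult_ac)
      qed
    qed (use t Kb_int K_integrable in \<open>auto intro!: integrable_on_mult_right\<close>)
    \<comment> \<open>The source between t and \<theta> is only known to be nonnegative and is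
      discarded.\<close>
    also have "\<dots> \<le> integral {0..\<theta>} (\<lambda>s. K N b s \<theta>)"
      by (rule integral_subset_le)
        (use \<theta> t Kb_int b.b_nonneg in \<open>auto simp: K_def intro!: mult_nonneg_nonneg\<close>)
    finally have le: "\<delta> powr (p - 1) * (k\<^sub>2 * It \<theta>) \<le> integral {0..\<theta>} (\<lambda>s. K N b s \<theta>)" .
    have nn: "0 \<le> k\<^sub>2 * It \<theta>"
      using k2_pos It_pos[of \<theta>] \<theta> t by (simp add: k\<^sub>2_def)
    have "\<delta> * Q \<theta> = phi_q p (\<delta> powr (p - 1) * (k\<^sub>2 * It \<theta>))"
      using nn \<delta>M p by (simp add: phi_q_mult phi_q_powr Q_def k\<^sub>2_def)
    also have "\<dots> \<le> b.slope \<theta>"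
      unfolding b.slope_def by (rule phi_q_mono[OF p _ le]) (use nn in simp)
    finally show ?thesis .
  qed
  have u_ge: "\<psi> r \<le> u r" if r: "r \<in> {0..\<rho>}" for r
  proof -
    have "\<psi> r = integral {max r t..\<rho>} (\<lambda>\<theta>. \<delta> * Q \<theta>)"
      by (simp add: \<psi>_def Psi_eq)
    also have "\<dots> \<le> integral {max r t..\<rho>} b.slope"
      by (rule integral_le)
        (use slope_ge r t slope_int Q_integrable in \<open>auto intro!: integrable_on_mult_right\<close>)
    also have "\<dots> \<le> integral {r..\<rho>} b.slope"
      by (rule integral_subset_le) (use slope_int r t b.slope_nonneg in auto)
    finally show ?thesis by (simp add: u_eq[OF r])
  qed
  have u_le: "u r \<le> Phi N p \<omega> \<rho> M r" if r: "r \<in> {0..\<rho>}" for r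
  proof -
    have "u r \<le> integral {r..\<rho>} (\<lambda>\<theta>. M * phi_q p (k1 N p \<omega> \<rho> * I \<theta>))"
      unfolding u_eq[OF r]
    proof (rule integral_le)
      show "(\<lambda>\<theta>. M * phi_q p (k1 N p \<omega> \<rho> * I \<theta>)) integrable_on {r..\<rho>}"
        by (intro integrable_on_mult_right integrable_continuous_real continuous_on_subset[OF phi_q_k1_I_cont])
          (use r in auto)
      show "b.slope \<theta> \<le> M * phi_q p (k1 N p \<omega> \<rho> * I \<theta>)" if "\<theta> \<in> {r..\<rho>}" for \<theta>
        using slope_le[of \<theta>] that r by (simp add: Gamma_bound_def I_def)
    qed (use slope_int r in auto)
    then show ?thesis by (simp add: Phi_eq)
  qed
  have u_le_M: "u r \<le> M" if "r \<in> {0..\<rho>}" for r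
    using u_le[OF that] Phi_le[OF that less_imp_le[OF M]] by linarith
  have slope_le_m: "b.slope r \<le> m" if "r \<in> {0..\<rho>}" for r
    using slope_le[OF that] Gamma_le[OF that] by linarith
  \<comment> \<open>By the bounds just obtained every clamp is inactive along the solution, so the
    truncated source is the original one.\<close>
  have b_eq: "b r = \<omega> r * f (u r) (b.slope r)" if "r \<in> {0..\<rho>}" for r
    using bF[OF that] u_ge[OF that] u_le_M[OF that] slope_le_m[OF that] b.slope_nonneg[of r]
    by (simp add: Fn_def \<alpha>_def \<beta>_def)
  have ball: "norm (x - x0) \<in> {0..\<rho>}" if "x \<in> ball x0 \<rho>" for x
    using that by (simp add: dist_norm norm_minus_commute)

  have U: "b.U = (\<lambda>x. u (norm (x - x0)))"
    by (simp add: b.U_def fun_eq_iff)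
  have "p_Laplace_weak_solution p (ball x0 \<rho>) (\<lambda>x a b. \<omega> (norm (x - x0)) * f a b) (\<lambda>x. u (norm (x - x0))) b.DU"
    unfolding U[symmetric]
    by (rule b.p_Laplace_weak_solution_U) (use b_eq[OF ball] in \<open>simp add: b.U_def b.norm_DU\<close>)
  moreover have "0 < u (norm (x - x0))" if "x \<in> ball x0 \<rho>" for x
    using u_ge[OF ball[OF that]] \<psi>_pos[of "norm (x - x0)"] that
    by (simp add: dist_norm norm_minus_commute)
  moreover have "GDERIV (\<lambda>y. u (norm (y - x0))) x :> b.DU x \<and>
      norm (b.DU x) \<le> Gamma_bound N p \<omega> \<rho> M (norm (x - x0))" if "x \<in> ball x0 \<rho>" for x
    using b.GDERIV_U[of x] slope_le[OF ball[OF that]] by (simp add: U b.norm_DU)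
  moreover have "ereal \<delta> \<le> Linf_norm (ball x0 \<rho>) (\<lambda>x. u (norm (x - x0)))"
  \<comment> \<open>On this ball the lower profile is constantly \<delta>.\<close>
  proof (rule Linf_norm_ge[of "ball x0 t"])
    show "\<delta> \<le> norm (u (norm (x - x0)))" if "x \<in> ball x0 t" for x
      using u_ge[of "norm (x - x0)"] \<psi>_t[of "norm (x - x0)"] that t
      by (simp add: dist_norm norm_minus_commute)
  qed (use t in auto)
  moreover have "Linf_norm (ball x0 \<rho>) (\<lambda>x. u (norm (x - x0))) \<le> ereal M"
  proof (rule Linf_norm_le)
    show "(\<lambda>x. u (norm (x - x0))) \<in> borel_measurable borel"
      using b.measurable_U by (simp only: U)
    show "norm (u (norm (x - x0))) \<le> M" if "x \<in> ball x0 \<rho>" for x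
      using u_le_M[OF ball[OF that]] u_ge[OF ball[OF that]] \<psi>_nonneg[OF ball[OF that]] by simp
  qed
  moreover have "Linf_norm (ball x0 \<rho>) b.DU \<le> ereal (gamma_rho N p \<omega> \<rho> * M)"
    by (rule Linf_norm_le[OF b.measurable_DU]) (use slope_le_m[OF ball] in \<open>simp add: b.norm_DU m_def\<close>)
  ultimately show ?thesis
    using u_ge u_le unfolding \<psi>_def by blast
qed

end
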